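(* Let $c_4 := \lim_{n\to\infty} k_4(n)/\binom{n}{4}$, where $k_4(n)$ denotes the minimum, over all 2-colourings of the edges of the complete graph $K_n$, of the number of monochromatic copies of $K_4$. Then $$c_4 \geq \frac{204603019}{7112448000} > 0.02876689.$$
   Context: Equivalently, $k_4(n) = \min\{k_4(G) + k_4(\bar G) : |V(G)| = n\}$, where $k_4(G)$ is the number of 4-vertex cliques in the graph $G$ and $\bar G$ is its complement. *)

theory Defs
  imports Complex_Main "HOL-Library.Ramsey"
begin

text \<open>
  The complete graph on \<open>n\<close> vertices has vertex set \<open>{..<n}\<close> and edge set
  \<open>nsets {..<n} 2\<close>. Its colourings are taken to be extensional functions (undefined
  outside the edges), so that there are finitely many of them and their minimum exists.
\<close>

definition two_colourings :: "nat \<Rightarrow> (nat set \<Rightarrow> bool) set" where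
  "two_colourings n = nsets {..<n} 2 \<rightarrow>\<^sub>E UNIV"

definition mono_K4s :: "nat \<Rightarrow> (nat set \<Rightarrow> bool) \<Rightarrow> nat set set" where
  "mono_K4s n c = {S \<in> nsets {..<n} 4. \<exists>t. \<forall>e \<in> nsets S 2. c e = t}"

definition k4 :: "nat \<Rightarrow> nat" where
  "k4 n = Min ((\<lambda>c. card (mono_K4s n c)) ` two_colourings n)"

definition c4 :: real where
  "c4 = lim (\<lambda>n. real (k4 n) / real (n choose 4))"

end

theory Submission
  imports Defs "HOL-Combinatorics.Multiset_Permutations" "HOL-Real_Asymp.Real_Asymp"
begin

text \<open>
  The proof is a flag algebra argument with flags on seven vertices. Fix an optimal colouring of
  \<open>K\<^sub>n\<close>. For an ordered 5-tuple \<open>xs\<close> of vertices and a further vertex \<open>y\<close>, the \<^emph>\<open>pattern\<close> of \<open>y\<close>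
  lists the colours of the edges from \<open>y\<close> to \<open>xs\<close>. A positive semidefinite form, depending on the
  colouring of \<open>xs\<close> only, in the patterns of two vertices \<open>y\<close>, \<open>z\<close> has a nonnegative sum over all
  \<open>y\<close>, \<open>z\<close>; discarding \<open>y = z\<close> costs \<open>O(n\<^sup>6)\<close> in total. Summing over \<open>xs\<close> and regrouping by the
  7-set \<open>xs \<union> {y, z}\<close> turns this into a linear inequality between the densities of coloured 7-sets,
  and the forms are chosen such that in every single 7-set a multiple of the number of monochromatic
  \<open>K\<^sub>4\<close> minus the value of the forms is at least the constant that corresponds to the density
  \<open>29/1008\<close>, which exceeds the bound to be proved. The forms come from a numerical solution of the
  semidefinite program, rounded to integers.
\<close>

section \<open>Sums over vertex subsets\<close>

text \<open>Working with ordered tuples instead of isomorphism classes of flags makes all averaging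
  plain double counting: a form acts on a tuple only if its colouring is literally a chosen
  representative, and the sum over all 120 orderings and both colour conventions restores
  invariance. Up to exchange of colours, the 34 graphs on five vertices, two of them
  self-complementary, collapse to 18 types.

  Constants: in each 7-set the sum over ordered pairs (y, z) is at least 1392000, and a
  monochromatic \<open>K\<^sub>4\<close> in a 5-set weighs 230400. As (n choose 7) =
  (n-4)(n-5)(n-6)(n choose 4) / 210, the density obtained is 1392000 / (210 * 230400) = 29/1008 =
  0.0287698..., about 3 * 10^-6 above the bound.

  The obstacle is the finite check, which is carried out by rewriting alone: 2^21 colourings of
  seven vertices, each with 21 pairs and 240 relabellings, are too many. Fixing the first five
  vertices to a representative leaves 18 * 2^11 = 36864 cases, extremality of the last two vertices
  removes more, and all gains are read off precomputed tables.\<close>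

lemma sum_nsets_remove:
  fixes f :: "'a set \<Rightarrow> 'a \<Rightarrow> 'b::comm_monoid_add"
  assumes "finite V"
  shows "(\<Sum>W\<in>nsets V (Suc k). \<Sum>z\<in>W. f (W - {z}) z) = (\<Sum>X\<in>nsets V k. \<Sum>z\<in>V - X. f X z)"
proof -
  have fin: "finite (nsets V j)" for j using assms by (simp add: finite_imp_finite_nsets)
  have fW: "\<forall>W\<in>nsets V j. finite W" for j by (auto simp: nsets_def)
  have "(\<Sum>W\<in>nsets V (Suc k). \<Sum>z\<in>W. f (W - {z}) z)
      = (\<Sum>(W,z)\<in>Sigma (nsets V (Suc k)) (\<lambda>W. W). f (W - {z}) z)"
    by (rule sum.Sigma[OF fin fW])
  also have "\<dots> = (\<Sum>(X,z)\<in>Sigma (nsets V k) (\<lambda>X. V - X). f X z)"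
    by (rule sum.reindex_bij_witness[where i="\<lambda>(X,z). (insert z X, z)" and j="\<lambda>(W,z). (W - {z}, z)"])
       (auto simp: nsets_def insert_absorb)
  also have "\<dots> = (\<Sum>X\<in>nsets V k. \<Sum>z\<in>V - X. f X z)"
    using assms by (subst sum.Sigma[OF fin]) auto
  finally show ?thesis .
qed

text \<open>Two vertices are removed one after the other; the swap in between brings the remaining
  sum into the shape to which the one-vertex version applies again. With \<open>k = 5\<close> this
  regroups a 5-set and two further vertices by their union.\<close>

lemma sum_nsets_remove2:
  fixes f :: "'a set \<Rightarrow> 'a \<Rightarrow> 'a \<Rightarrow> 'b::comm_monoid_add"
  assumes "finite V"
  shows "(\<Sum>W\<in>nsets V (Suc (Suc k)). \<Sum>z\<in>W. \<Sum>y\<in>W - {z}. f (W - {z} - {y}) y z)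
       = (\<Sum>X\<in>nsets V k. \<Sum>y\<in>V - X. \<Sum>z\<in>V - X - {y}. f X y z)"
proof -
  have "(\<Sum>W\<in>nsets V (Suc (Suc k)). \<Sum>z\<in>W. \<Sum>y\<in>W - {z}. f (W - {z} - {y}) y z)
      = (\<Sum>W\<in>nsets V (Suc k). \<Sum>z\<in>V - W. \<Sum>y\<in>W. f (W - {y}) y z)"
    by (rule sum_nsets_remove[OF assms, where f="\<lambda>W z. \<Sum>y\<in>W. f (W - {y}) y z"])
  also have "\<dots> = (\<Sum>W\<in>nsets V (Suc k). \<Sum>y\<in>W. \<Sum>z\<in>V - W. f (W - {y}) y z)"
    by (intro sum.cong refl sum.swap)
  also have "\<dots> = (\<Sum>W\<in>nsets V (Suc k). \<Sum>y\<in>W. \<Sum>z\<in>V - (W - {y}) - {y}. f (W - {y}) y z)"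
    by (intro sum.cong refl) auto
  also have "\<dots> = (\<Sum>X\<in>nsets V k. \<Sum>y\<in>V - X. \<Sum>z\<in>V - X - {y}. f X y z)"
    by (rule sum_nsets_remove[OF assms, where f="\<lambda>X y. \<Sum>z\<in>V - X - {y}. f X y z"])
  finally show ?thesis .
qed

section \<open>Forms in patterns\<close>

text \<open>The upper triangle of the adjacency matrix, row by row; on five vertices it is the
  ten-bit encoding of types.\<close>

fun bits :: "('v \<Rightarrow> 'v \<Rightarrow> bool) \<Rightarrow> 'v list \<Rightarrow> bool list" where
  "bits g [] = []"
| "bits g (x # xs) = map (g x) xs @ bits g xs"

definition flip :: "bool \<Rightarrow> ('v \<Rightarrow> 'v \<Rightarrow> bool) \<Rightarrow> 'v \<Rightarrow> 'v \<Rightarrow> bool" where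
  "flip b g u v \<longleftrightarrow> g u v \<noteq> b"

definition monochromatic :: "('v \<Rightarrow> 'v \<Rightarrow> bool) \<Rightarrow> 'v set \<Rightarrow> bool" where
  "monochromatic g S \<longleftrightarrow> (\<exists>t. \<forall>u\<in>S. \<forall>v\<in>S. u \<noteq> v \<longrightarrow> g u v = t)"

text \<open>The 4-subsets are indexed by the omitted vertex, so this counts monochromatic
  \<open>K\<^sub>4\<close>s when \<open>X\<close> has five elements.\<close>

definition k4_in :: "('v \<Rightarrow> 'v \<Rightarrow> bool) \<Rightarrow> 'v set \<Rightarrow> int" where
  "k4_in g X = (\<Sum>x\<in>X. of_bool (monochromatic g (X - {x})))"

text \<open>Each 4-set extends to a 5-set by any of the \<open>card V - 4\<close> vertices outside
  it.\<close>

lemma sum_k4_in: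
  assumes "finite V"
  shows "(\<Sum>X\<in>nsets V 5. k4_in g X) = int (card V - 4) * int (card {S \<in> nsets V 4. monochromatic g S})"
proof -
  have "(\<Sum>X\<in>nsets V 5. k4_in g X) = (\<Sum>X\<in>nsets V (Suc 4). \<Sum>x\<in>X. of_bool (monochromatic g (X - {x})))"
    by (simp add: k4_in_def)
  also have "\<dots> = (\<Sum>S\<in>nsets V 4. \<Sum>x\<in>V - S. of_bool (monochromatic g S))"
    by (rule sum_nsets_remove[OF assms, where f="\<lambda>S x. of_bool (monochromatic g S)"])
  also have "\<dots> = (\<Sum>S\<in>nsets V 4. int (card V - 4) * of_bool (monochromatic g S))"
    by (intro sum.cong refl) (use assms in \<open>auto simp: nsets_def card_Diff_subset\<close>)
  also have "\<dots> = int (card V - 4) * int (card {S \<in> nsets V 4. monochromatic g S})"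
  proof -
    have "(\<Sum>S\<in>nsets V 4. of_bool (monochromatic g S)) = int (card {S \<in> nsets V 4. monochromatic g S})"
      using finite_imp_finite_nsets[OF assms, of 4] by (simp add: Collect_conj_eq Int_commute)
    then show ?thesis by (simp flip: sum_distrib_left)
  qed
  finally show ?thesis .
qed

text \<open>Positivity in the form that counting needs: \<open>p\<close> assigns a pattern to every
  vertex, so the double sum is the quadratic form at the vector of pattern multiplicities. Nothing
  else about the certificate enters the passage from 7-sets to large \<open>n\<close>.\<close>

locale psd_form =
  fixes a :: int and q :: "bool list \<Rightarrow> bool list \<Rightarrow> bool list \<Rightarrow> int"
  assumes psd: "\<And>(U :: nat set) T p. finite U \<Longrightarrow> 0 \<le> (\<Sum>y\<in>U. \<Sum>z\<in>U. q T (p y) (p z))"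
begin

text \<open>Summing over both values of \<open>b\<close> makes the form blind to an exchange of the
  colours, so only one type of each complementary pair has to carry vectors.\<close>

definition ordered_form :: "('v \<Rightarrow> 'v \<Rightarrow> bool) \<Rightarrow> 'v list \<Rightarrow> 'v \<Rightarrow> 'v \<Rightarrow> int" where
  "ordered_form g xs y z =
     (\<Sum>b\<in>UNIV. q (bits (flip b g) xs) (map (flip b g y) xs) (map (flip b g z) xs))"

definition excess :: "('v \<Rightarrow> 'v \<Rightarrow> bool) \<Rightarrow> 'v set \<Rightarrow> 'v \<Rightarrow> 'v \<Rightarrow> int" where
  "excess g X y z = a * k4_in g X - (\<Sum>xs\<in>permutations_of_set X. ordered_form g xs y z)"

text \<open>Only finitely many bit lists occur, of length 10 for the type and 5 for the pattern, so
  the bound is uniform in the colouring and hence in the number of vertices.\<close>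

lemma ordered_form_bounded:
  "\<exists>C. \<forall>(g :: 'v \<Rightarrow> 'v \<Rightarrow> bool) xs y. length xs = 5 \<longrightarrow> ordered_form g xs y y \<le> C"
proof -
  have len: "length (bits h xs) \<le> 10" if "length xs = 5" for h :: "'v \<Rightarrow> 'v \<Rightarrow> bool" and xs
    using that by (auto simp: numeral_eq_Suc length_Suc_conv)
  let ?A = "{T :: bool list. set T \<subseteq> UNIV \<and> length T \<le> 10}"
  have fin: "finite ?A" by (rule finite_lists_length_le) simp
  let ?S = "(\<lambda>(T, p). q T p p) ` (?A \<times> ?A)"
  have finS: "finite ?S" using fin by blast
  have "ordered_form g xs y y \<le> 2 * Max ?S" if "length xs = 5" for g :: "'v \<Rightarrow> 'v \<Rightarrow> bool" and xs y
  proof -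
    have "q (bits (flip b g) xs) (map (flip b g y) xs) (map (flip b g y) xs) \<le> Max ?S" for b
      by (rule Max_ge[OF finS]) (use len[OF that] that in auto)
    from this[of True] this[of False] show ?thesis
      by (simp add: ordered_form_def UNIV_bool)
  qed
  then show ?thesis by blast
qed

text \<open>Positivity concerns the full double sum; dropping the diagonal costs at most
  \<open>C\<close> per vertex.\<close>

lemma ordered_form_offdiag:
  fixes g :: "nat \<Rightarrow> nat \<Rightarrow> bool"
  assumes "finite U" and C: "\<And>y. ordered_form g xs y y \<le> C"
  shows "- (int (card U) * C) \<le> (\<Sum>y\<in>U. \<Sum>z\<in>U - {y}. ordered_form g xs y z)"
proof -
  have "(\<Sum>y\<in>U. \<Sum>z\<in>U. ordered_form g xs y z)
     = (\<Sum>b\<in>UNIV. \<Sum>y\<in>U. \<Sum>z\<in>U. q (bits (flip b g) xs) (map (flip b g y) xs) (map (flip b g z) xs))"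
    by (simp add: ordered_form_def UNIV_bool sum.distrib)
  then have nonneg: "0 \<le> (\<Sum>y\<in>U. \<Sum>z\<in>U. ordered_form g xs y z)"
    using psd[OF assms(1)] by (simp add: sum_nonneg)
  have "(\<Sum>y\<in>U. \<Sum>z\<in>U. ordered_form g xs y z)
      = (\<Sum>y\<in>U. ordered_form g xs y y + (\<Sum>z\<in>U - {y}. ordered_form g xs y z))"
    using assms(1) by (intro sum.cong refl sum.remove)
  also have "\<dots> \<le> (\<Sum>y\<in>U. C) + (\<Sum>y\<in>U. \<Sum>z\<in>U - {y}. ordered_form g xs y z)"
    unfolding sum.distrib by (intro add_right_mono sum_mono C)
  finally show ?thesis using nonneg by simp
qed

text \<open>The 7-set bounds are summed and regrouped by 5-sets. There the \<open>K\<^sub>4\<close>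
  term occurs (n-5)(n-6) times, and \<open>sum_k4_in\<close> supplies the factor n-4. The diagonal
  is paid for once per ordering, whence 120.\<close>

lemma local_to_global:
  assumes "\<And>(g :: nat \<Rightarrow> nat \<Rightarrow> bool) xs y. length xs = 5 \<Longrightarrow> ordered_form g xs y y \<le> C" and "0 \<le> C"
    and loc: "\<And>W. W \<in> nsets {..<n} 7 \<Longrightarrow> L \<le> (\<Sum>z\<in>W. \<Sum>y\<in>W - {z}. excess g (W - {z} - {y}) y z)"
    and n: "n \<ge> 7"
  shows "L * int (n choose 7) \<le>
      a * (int (n - 4) * int (n - 5) * int (n - 6)) * int (card {S \<in> nsets {..<n} 4. monochromatic g S})
      + 120 * C * int n * int (n choose 5)"
proof -
  let ?V = "{..<n}"
  have cU: "card (?V - X) = n - 5" "finite (?V - X)" if "X \<in> nsets ?V 5" for X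
    using that by (auto simp: nsets_def card_Diff_subset)
  have one: "(\<Sum>y\<in>?V - X. \<Sum>z\<in>?V - X - {y}. excess g X y z)
      \<le> a * (int (n - 5) * int (n - 6)) * k4_in g X + 120 * C * int n" if X: "X \<in> nsets ?V 5" for X
  proof -
    let ?U = "?V - X"
    have fX: "finite X" "card X = 5" using X by (auto simp: nsets_def)
    have perms: "- (int n * C) \<le> (\<Sum>y\<in>?U. \<Sum>z\<in>?U - {y}. ordered_form g xs y z)"
      if "xs \<in> permutations_of_set X" for xs
    proof -
      have len: "length xs = 5" using that fX by (metis length_finite_permutations_of_set)
      \<comment> \<open>There are \<open>n - 5\<close> vertices outside \<open>X\<close>; enlarging
        this to \<open>n\<close> uses \<open>0 \<le> C\<close>.\<close>
      have "- (int n * C) \<le> - (int (card ?U) * C)"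
        using cU[OF X] \<open>0 \<le> C\<close> by (simp add: mult_right_mono)
      also have "\<dots> \<le> (\<Sum>y\<in>?U. \<Sum>z\<in>?U - {y}. ordered_form g xs y z)"
        by (rule ordered_form_offdiag) (use cU[OF X] assms(1)[OF len] in auto)
      finally show ?thesis .
    qed
    have "(\<Sum>xs\<in>permutations_of_set X. - (int n * C))
        \<le> (\<Sum>xs\<in>permutations_of_set X. \<Sum>y\<in>?U. \<Sum>z\<in>?U - {y}. ordered_form g xs y z)"
      by (intro sum_mono perms)
    also have "\<dots> = (\<Sum>y\<in>?U. \<Sum>xs\<in>permutations_of_set X. \<Sum>z\<in>?U - {y}. ordered_form g xs y z)"
      by (rule sum.swap)
    also have "\<dots> = (\<Sum>y\<in>?U. \<Sum>z\<in>?U - {y}. \<Sum>xs\<in>permutations_of_set X. ordered_form g xs y z)"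
      by (intro sum.cong refl sum.swap)
    finally have "- (120 * C * int n)
        \<le> (\<Sum>y\<in>?U. \<Sum>z\<in>?U - {y}. \<Sum>xs\<in>permutations_of_set X. ordered_form g xs y z)"
      using fX by (simp add: fact_numeral mult_ac)
    moreover have "(\<Sum>y\<in>?U. \<Sum>z\<in>?U - {y}. a * k4_in g X) = a * (int (n - 5) * int (n - 6)) * k4_in g X"
      using cU[OF X] by simp
    ultimately show ?thesis unfolding excess_def sum_subtractf by linarith
  qed
  have "L * int (n choose 7) = (\<Sum>W\<in>nsets ?V 7. L)" by simp
  also have "\<dots> \<le> (\<Sum>W\<in>nsets ?V 7. \<Sum>z\<in>W. \<Sum>y\<in>W - {z}. excess g (W - {z} - {y}) y z)"
    by (intro sum_mono loc)
  also have "\<dots> = (\<Sum>X\<in>nsets ?V 5. \<Sum>y\<in>?V - X. \<Sum>z\<in>?V - X - {y}. excess g X y z)"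
    using sum_nsets_remove2[of ?V "excess g" 5] by simp
  also have "\<dots> \<le> (\<Sum>X\<in>nsets ?V 5. a * (int (n - 5) * int (n - 6)) * k4_in g X + 120 * C * int n)"
    by (intro sum_mono one)
  also have "\<dots> = a * (int (n - 5) * int (n - 6)) * (\<Sum>X\<in>nsets ?V 5. k4_in g X)
      + 120 * C * int n * int (n choose 5)"
    by (simp add: sum.distrib sum_distrib_left)
  also have "\<dots> = a * (int (n - 4) * int (n - 5) * int (n - 6)) * int (card {S \<in> nsets {..<n} 4. monochromatic g S})
      + 120 * C * int n * int (n choose 5)"
    by (simp add: sum_k4_in)
  finally show ?thesis .
qed

end

section \<open>The certificate\<close>

text \<open>Tables over bit lists: rewriting reaches an entry in as many steps as the key has
  bits.\<close>

datatype 'a trie = Leaf 'a | Node "'a trie" "'a trie"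

fun lookup :: "'a trie \<Rightarrow> bool list \<Rightarrow> 'a" where
  "lookup (Leaf a) bs = a"
| "lookup (Node l r) (b # bs) = lookup (if b then r else l) bs"
| "lookup (Node l r) [] = undefined"

fun pair_up :: "'a trie list \<Rightarrow> 'a trie list" where
  "pair_up (l # r # ts) = Node l r # pair_up ts"
| "pair_up ts = ts"

text \<open>The tree grows from the leaves upwards by joining neighbours, so leaves listed
  lexicographically, \<open>False\<close> first, end up under their own keys.\<close>

primrec trie_of :: "nat \<Rightarrow> 'a trie list \<Rightarrow> 'a trie" where
  "trie_of 0 ts = hd ts"
| "trie_of (Suc n) ts = trie_of n (pair_up ts)"

primrec tabulate :: "nat \<Rightarrow> (bool list \<Rightarrow> 'a) \<Rightarrow> bool list \<Rightarrow> 'a trie" where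
  "tabulate 0 f pre = Leaf (f pre)"
| "tabulate (Suc n) f pre = Node (tabulate n f (pre @ [False])) (tabulate n f (pre @ [True]))"

text \<open>
  A colouring of \<open>{0,1,2,3,4}\<close> is encoded by its list of ten bits for the edges
  \<open>01, 02, 03, 04, 12, 13, 14, 23, 24, 34\<close>; \<open>rel\<close> decodes it.
\<close>

definition rel :: "bool list \<Rightarrow> nat \<Rightarrow> nat \<Rightarrow> bool" where
  "rel T i j = T ! (min i j * (9 - min i j) div 2 + (max i j - min i j - 1))"

text \<open>\<open>\<pi>\<close> lists old positions in their new order, as in
  \<open>map ((!) xs) \<pi>\<close>; an exchange of colours also affects the edges to the extra
  vertex.\<close>

definition act :: "bool \<Rightarrow> nat list \<Rightarrow> bool list \<Rightarrow> bool list" where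
  "act b \<pi> p = map (\<lambda>i. p ! i \<noteq> b) \<pi>"

definition relabel :: "bool \<Rightarrow> nat list \<Rightarrow> bool list \<Rightarrow> bool list" where
  "relabel b \<pi> T = bits (flip b (rel T)) \<pi>"

text \<open>One representative of each colouring of \<open>K\<^sub>5\<close> up to isomorphism and exchange of the colours.\<close>

definition types :: "bool list list" where
  "types = map (map ((=) (1::nat)))
     [[0,0,0,0,0,0,0,0,0,1], [0,0,0,0,0,0,0,0,1,1], [0,0,0,0,0,0,1,0,1,1], [0,0,0,0,0,0,1,1,0,0],
     [0,0,0,0,0,0,1,1,0,1], [0,0,0,1,0,0,1,1,0,1], [0,0,0,0,0,0,1,1,1,1], [0,0,0,0,0,1,1,1,1,0],
     [0,0,0,0,0,1,1,1,1,1], [0,0,0,1,1,1,0,1,0,0], [0,0,0,0,1,1,1,1,1,1], [0,0,0,0,0,0,0,0,0,0],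
     [0,0,0,1,0,0,1,1,0,0], [0,0,0,0,0,0,0,1,1,1], [0,0,0,1,0,1,0,1,1,0], [0,0,0,1,0,1,1,1,1,0],
     [0,0,0,1,0,1,0,1,1,1], [0,0,1,1,1,0,1,1,0,0]]"

text \<open>
  For each of the first eleven types, a weight and integer vectors indexed by the 32 patterns in
  lexicographic order. The form is the weighted sum of the squares of these vectors. The remaining
  types do not contribute. The weight is 24 divided by the number of automorphisms of the type,
  because the sum over all orderings of a 5-set counts every automorphism.
\<close>

definition vectors :: "(nat \<times> int list list) list" where
  "vectors = [
    (2, [
      [145, -150, -6, 107, -27, 145, 123, 157, 59, 207, 186, 59, 73, 186, 193, 211, -376, -73, -96,
      25, -297, -124, -120, 210, 8, -165, -162, 125, -180, -146, 63, 18],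
      [-216, -1, -4, -63, -20, -55, -56, 59, -20, -54, -56, 62, -50, 8, 9, 52, -18, -60, -54, 63,
      -50, 7, 11, 52, -52, 8, 0, 53, -74, 98, 97, 98],
      [27, -27, -31, -31, -49, -18, -13, 50, -51, -12, -11, 42, 5, 38, 39, 30, -49, -10, -18, 43,
      2, 37, 36, 29, 3, 40, 38, 28, 161, 14, 17, -87],
      [15, -61, -59, 10, 0, -13, -8, -22, -2, -10, -14, -22, 23, 10, -3, 2, -3, -5, -8, -21, 9, 8,
      23, -13, 16, 5, 0, 6, -11, 22, 26, 21]]),
    (6, [
      [242, 101, 104, 70, -106, 251, 1, 128, -77, 86, 71, -36, -13, 59, -111, 123, -30, -144, -76,
      98, -158, 195, 72, 99, 15, -163, -203, -28, -58, 47, -183, -9],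
      [85, 246, 123, -27, 44, -103, -87, -161, 102, 88, 19, 46, -41, 27, -66, -61, 67, 82, 55, 33,
      -10, 13, 8, -63, 124, 64, 41, 22, -24, 21, -131, -115],
      [-168, -2, 13, -6, 14, -6, -103, 86, -16, 81, -41, -9, -44, -4, -125, 50, -15, 80, -43, -7,
      -42, -5, -124, 49, 61, 85, -76, 24, -79, 25, -35, 94],
      [75, -33, -2, -59, -3, -59, 16, 58, -38, -9, 47, -49, 45, -54, -26, 26, -40, -8, 45, -49, 44,
      -50, -26, 21, 22, 41, -50, 48, -48, 51, -7, -102],
      [-1, 11, -53, 45, -53, 44, 89, -44, 4, 39, 11, -20, 9, -20, -57, -25, 8, 39, 12, -18, 10,
      -17, -54, -24, 76, -60, -3, -9, -6, 1, 39, -8],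
      [-57, 75, -20, 26, -20, 26, -5, 26, -65, 26, 4, -1, 6, -5, 40, 3, -66, 23, 6, -1, 4, 2, 39,
      2, -9, 20, 9, -22, 9, -15, 11, -63]]),
    (4, [
      [-58, 221, -269, 157, -17, 99, 28, -97, 53, -79, -4, -57, -52, -62, -160, -198, 126, 113,
      173, -55, 228, 116, 66, 269, -129, -17, -137, -130, 252, 16, 99, -215],
      [7, 29, 56, -51, 57, -70, -36, 82, 72, -131, -88, 36, -103, 19, 46, -91, 54, 63, 41, -42, 20,
      -31, 104, -207, -38, -16, 39, -97, 21, -62, 29, -60],
      [-87, -24, 25, 1, 28, -1, 5, 0, 25, 2, 4, 0, 3, -4, -88, -16, -28, 164, -65, 35, -65, 34,
      -81, -16, -63, 33, -79, -19, -80, -16, 37, -17],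
      [15, 28, 26, -77, 32, -78, -16, -23, 25, -72, -22, -16, -18, -17, -40, 87, -33, -7, 12, 27,
      12, 25, 0, 46, 15, 29, 0, 49, -1, 49, -4, -59]]),
    (3, [
      [90, 56, -167, -248, 262, 129, -219, -213, 112, 48, -204, -242, 177, 67, -175, -139, 209,
      190, -107, -99, 201, 168, -195, -118, 228, 174, -64, -71, 203, 148, -89, 17],
      [180, 155, 157, 90, 156, 91, 55, -4, 155, 54, 91, -2, 91, 0, -2, -83, -72, -54, -54, -71,
      -56, -72, -27, -74, -54, -28, -70, -75, -71, -74, -74, -59],
      [79, -31, -34, 13, -31, 13, -48, 37, -29, -46, 14, 35, 15, 41, 36, 24, 95, 8, 7, -18, 6, -21,
      -4, -17, 7, 1, -17, -15, -19, -17, -17, -80]]),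
    (12, [
      [83, 168, 10, -106, 70, 203, -155, -371, 126, 130, -66, -85, 111, 135, -135, -225, 169, 182,
      -66, -22, 94, 216, -114, -184, 104, 111, -110, -144, 72, 170, -47, -203],
      [199, 329, 73, 216, 147, 178, 97, 161, -32, -17, -40, -85, -83, 8, -23, -51, -11, -7, -39,
      52, 114, -22, 127, 38, -145, -103, -168, -71, -212, -70, -113, -28],
      [93, -62, -94, -48, 43, 73, 62, -42, 186, 50, 78, 48, 206, 145, 137, 31, -109, -102, -82,
      -127, 26, -125, -77, 23, -184, -13, -17, -129, 2, -18, -12, 54],
      [58, -31, -70, 56, 25, 29, -79, 27, -47, 73, 119, 45, -171, 8, 43, -13, 36, -8, -53, -131,
      66, 46, 10, -37, 2, -21, 45, -24, 38, -12, 82, -3],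
      [55, -55, -9, -18, 58, -33, 27, -20, -33, -22, -9, -10, -35, 22, -2, -7, 33, 53, 19, 16, -64,
      28, -30, 9, -100, 41, 27, 4, -65, 35, 28, -13],
      [43, -24, -24, -1, 0, -9, -10, -14, 1, -9, -7, -17, 4, -6, -5, -32, -14, 51, 52, -45, 17, 3,
      31, 10, 19, 23, 5, 8, 6, -61, -61, 55],
      [-6, 5, 4, 20, -13, -10, 12, -2, -13, 5, -13, -4, -15, 31, 22, -10, -16, 14, 16, 15, -4, 6,
      -7, -18, 5, -17, -6, -22, 4, 1, 1, 11]]),
    (12, [
      [16, -139, 233, 26, -163, -275, 2, 95, -136, -260, 90, -117, -266, -327, -31, -19, 127, 133,
      284, 269, -28, -22, 88, 183, 58, -64, 128, 125, -128, -120, 41, 138],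
      [97, 117, 198, 15, 42, 55, -37, -225, 133, 31, 220, -42, -50, -99, -23, -148, 179, -21, 106,
      -85, 95, -22, -44, -186, 109, 27, 109, -159, 2, -85, -27, -220],
      [47, 100, 35, 132, 35, 79, 112, 195, 24, -60, 40, -47, 5, -29, 64, 30, -78, -61, -39, -1,
      -22, 24, 101, 74, -40, -224, -66, -175, -12, -155, 61, -110],
      [-21, 96, 30, 137, -39, 40, -5, -48, -21, 42, -40, 130, -14, -62, 28, -26, -20, 42, -40, 129,
      -13, -61, 31, -28, 8, 63, -89, 2, -77, 24, -26, -9],
      [-15, 22, 19, 106, -62, -10, -14, 14, 23, 4, 25, -40, -74, 99, -52, -5, 22, 1, 28, -39, -75,
      100, -52, -7, 15, 8, -69, 38, 2, 1, -33, 1],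
      [94, -27, 66, -63, -47, 47, -8, 10, 4, 19, -17, -25, -24, 17, 29, 8, 5, 21, -19, -22, -25,
      16, 31, 9, -43, 43, -38, -41, -66, 29, 29, 19],
      [20, 21, 14, 7, 67, -46, 23, -16, -5, 10, 13, 25, -18, 1, -43, 44, -7, 8, 14, 21, -20, 6,
      -44, 46, -84, 28, 9, -25, 4, 36, 16, -40],
      [20, -13, 17, 24, 24, -17, -5, -13, -38, 19, 5, -5, 3, 18, 27, -30, -39, 20, 13, -5, 5, 15,
      25, -29, -32, -15, 17, 12, 8, -2, -30, 10]]),
    (12, [
      [89, 129, -19, 148, -32, 57, -90, -158, 120, 145, 133, -47, -115, 118, -117, -28, 49, 76,
      108, -43, -11, -4, -140, -67, -4, 79, -15, -67, 49, -119, -98, -32],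
      [69, 103, 33, 164, 89, -23, -22, 63, -81, -93, -21, -90, -64, -210, -16, -82, 93, 3, 61, 115,
      151, -37, 62, 0, 25, -72, 1, 9, 48, -114, 23, -2],
      [-81, 33, -81, 41, -37, 96, -24, 131, -101, 23, -37, -52, 41, 0, -93, 70, -36, -9, -25, 49,
      -6, 76, -44, 99, -16, 136, -97, 63, 110, -15, -79, 32],
      [24, -17, 9, 4, 97, -26, 35, -27, 27, 4, 70, -73, 96, -90, -17, 19, -10, 0, -54, 8, -101, 88,
      -30, -45, -14, 23, 36, 9, -10, -42, -15, 1],
      [24, -4, 1, 10, 0, 12, -8, 82, -9, 30, 62, 2, 61, 3, 66, -65, -43, 5, 16, -43, 15, -43, -14,
      21, -10, 23, 8, -23, 8, -24, 4, -62],
      [-12, -7, -31, -33, -25, -29, -7, -16, 5, 5, 9, -4, 10, -4, -36, -11, 9, 31, 0, 25, 3, 26, 7,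
      47, -22, -27, 24, -21, 21, -20, 32, -53]]),
    (3, [
      [174, -51, 151, 278, 159, -115, 84, -58, 9, -29, 62, 263, -83, -25, 29, -170, -18, 271, -65,
      192, -237, -44, -216, -215, 30, 213, 214, 48, -277, -129, 55, -99],
      [51, -16, 12, 20, -137, -16, -9, -23, 11, 10, 18, -67, 78, -80, -91, 20, 87, 60, 56, 0, 75,
      -68, -52, 63, 58, 19, 47, -62, -49, -14, -40, -65],
      [4, 60, 52, -5, 53, 1, 3, -31, 61, 2, 4, -14, -4, -33, -21, 35, 73, -32, -27, -38, -34, -2,
      -8, 6, -30, -10, -12, 8, -41, 9, 19, 12]]),
    (6, [
      [142, 193, -36, 263, 129, 72, -9, 117, -69, 42, -37, -195, -168, 50, -280, -101, 36, 123,
      161, 148, -56, 254, 1, 63, -91, -20, -272, -76, -43, -158, -207, -135],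
      [156, 75, 4, 2, 134, -187, -14, -100, 188, 85, 257, -33, 75, 41, 86, -96, -47, -107, -4,
      -134, 40, 13, -35, -129, 44, -80, -130, -89, -1, -53, 16, -29],
      [-54, -12, -112, -72, 84, 4, -39, -118, -18, 27, -21, -114, 75, -20, -13, -5, 96, -90, 89,
      162, 5, -34, 40, -58, 23, -4, 65, -49, -7, 22, -14, -76],
      [53, -1, -6, -76, 59, -35, -37, -48, 58, -37, -37, -48, -64, 1, 0, 25, 9, 23, 22, -42, -49,
      12, 17, 78, -44, 11, 15, 79, -4, 23, 21, -7],
      [23, -14, -8, -7, -9, -19, -16, 15, -7, -20, -14, 13, -30, -4, -8, 31, -40, 7, 10, -3, 14, 7,
      13, -33, 14, 6, 10, -31, 3, 1, 4, -28]]),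
    (2, [
      [237, 150, 93, 133, 47, -71, -148, -115, 160, 200, 156, 159, 32, -2, -166, -244, -115, 12,
      -128, -24, -102, -146, -201, -179, 64, 165, 15, -17, -21, -81, 124, -82],
      [-2, 0, 45, 77, 48, 76, 105, 36, 44, 78, 104, 33, 104, 34, 131, 121, 18, -143, -82, -111,
      -82, -112, 8, -42, -81, -111, 10, -42, 7, -42, -67, -5],
      [3, -6, 13, -22, 14, -18, 3, 68, -13, -23, -21, 60, -20, 63, -4, 13, 8, 4, 16, 0, 15, -1,
      -59, 4, 12, 3, -67, 6, -63, 4, -23, 0]]),
    (1, [
      [70, 153, -113, -37, -147, -55, -102, -10, 56, 214, 167, 357, 150, 298, -156, 163, -204,
      -122, -118, -100, -140, -107, -132, -330, 255, 3, -20, -69, -24, -67, 109, -133]])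
  ]"

text \<open>
  The 1024 colourings in lexicographic order. The entry \<open>(j, b, \<pi>)\<close> says that relabelling by \<open>\<pi>\<close>
  and exchanging the colours if \<open>b\<close> yields \<open>types ! j\<close>.
\<close>

definition canon_table :: "(nat \<times> bool \<times> nat list) list list" where
  "canon_table = (let f = False; t = True in [
    [(11,f,[0,1,2,3,4]), (0,f,[0,1,2,3,4]), (0,f,[0,1,3,2,4]), (1,f,[0,1,2,3,4]),
    (0,f,[0,1,4,2,3]), (1,f,[0,1,2,4,3]), (1,f,[0,1,3,4,2]), (13,f,[0,1,2,3,4]), (0,f,[0,2,3,1,4]),
    (1,f,[0,2,1,3,4]), (1,f,[0,3,1,2,4]), (2,f,[0,1,2,3,4]), (3,f,[0,1,2,3,4]), (4,f,[0,1,2,3,4]),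
    (4,f,[0,1,3,2,4]), (6,f,[0,1,2,3,4])],
    [(0,f,[0,2,4,1,3]), (1,f,[0,2,1,4,3]), (3,f,[0,1,2,4,3]), (4,f,[0,1,2,4,3]), (1,f,[0,4,1,2,3]),
    (2,f,[0,1,2,4,3]), (4,f,[0,1,4,2,3]), (6,f,[0,1,2,4,3]), (1,f,[0,2,3,4,1]), (13,f,[0,2,1,3,4]),
    (4,f,[0,2,3,1,4]), (6,f,[0,2,1,3,4]), (4,f,[0,2,4,1,3]), (6,f,[0,2,1,4,3]), (7,f,[0,1,2,3,4]),
    (8,f,[0,1,2,3,4])],
    [(0,f,[0,3,4,1,2]), (3,f,[0,1,3,4,2]), (1,f,[0,3,1,4,2]), (4,f,[0,1,3,4,2]), (1,f,[0,4,1,3,2]),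
    (4,f,[0,1,4,3,2]), (2,f,[0,1,3,4,2]), (6,f,[0,1,3,4,2]), (1,f,[0,3,2,4,1]), (4,f,[0,2,3,4,1]),
    (13,f,[0,3,1,2,4]), (6,f,[0,3,1,2,4]), (4,f,[0,3,4,1,2]), (7,f,[0,1,3,2,4]), (6,f,[0,3,1,4,2]),
    (8,f,[0,1,3,2,4])],
    [(1,f,[0,4,2,3,1]), (4,f,[0,2,4,3,1]), (4,f,[0,3,4,2,1]), (7,f,[0,1,4,2,3]),
    (13,f,[0,4,1,2,3]), (6,f,[0,4,1,2,3]), (6,f,[0,4,1,3,2]), (8,f,[0,1,4,2,3]), (2,f,[0,2,3,4,1]),
    (6,f,[0,2,3,4,1]), (6,f,[0,3,2,4,1]), (8,f,[0,2,3,1,4]), (6,f,[0,4,2,3,1]), (8,f,[0,2,4,1,3]),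
    (8,f,[0,3,4,1,2]), (10,f,[0,1,2,3,4])],
    [(0,f,[1,2,3,0,4]), (1,f,[1,2,0,3,4]), (1,f,[1,3,0,2,4]), (2,f,[1,0,2,3,4]), (3,f,[1,0,2,3,4]),
    (4,f,[1,0,2,3,4]), (4,f,[1,0,3,2,4]), (6,f,[1,0,2,3,4]), (1,f,[2,3,0,1,4]), (2,f,[2,0,1,3,4]),
    (2,f,[3,0,1,2,4]), (10,t,[4,0,1,2,3]), (12,f,[0,1,2,3,4]), (5,f,[0,1,2,3,4]),
    (5,f,[0,1,3,2,4]), (8,t,[4,2,3,0,1])],
    [(3,f,[2,0,1,3,4]), (4,f,[2,0,1,3,4]), (12,f,[0,2,1,3,4]), (5,f,[0,2,1,3,4]),
    (12,f,[1,2,0,4,3]), (5,f,[1,2,0,4,3]), (14,f,[0,1,2,3,4]), (16,f,[0,1,2,3,4]),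
    (4,f,[2,0,3,1,4]), (6,f,[2,0,1,3,4]), (5,f,[0,2,3,1,4]), (8,t,[4,1,3,0,2]), (14,f,[0,2,1,3,4]),
    (16,f,[0,2,1,3,4]), (15,f,[0,1,2,3,4]), (6,t,[4,3,1,2,0])],
    [(3,f,[3,0,1,2,4]), (12,f,[0,3,1,2,4]), (4,f,[3,0,1,2,4]), (5,f,[0,3,1,2,4]),
    (12,f,[1,3,0,4,2]), (14,f,[0,1,3,2,4]), (5,f,[1,3,0,4,2]), (16,f,[0,1,3,2,4]),
    (4,f,[3,0,2,1,4]), (5,f,[0,3,2,1,4]), (6,f,[3,0,1,2,4]), (8,t,[4,1,2,0,3]), (14,f,[0,3,1,2,4]),
    (15,f,[0,1,3,2,4]), (16,f,[0,3,1,2,4]), (6,t,[4,2,1,3,0])],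
    [(12,f,[2,3,0,4,1]), (14,f,[0,2,3,1,4]), (14,f,[0,3,2,1,4]), (15,f,[0,2,3,1,4]),
    (9,f,[0,1,2,3,4]), (15,t,[3,1,2,4,0]), (15,t,[2,1,3,4,0]), (5,t,[2,3,4,1,0]),
    (5,f,[2,3,0,4,1]), (16,f,[0,2,3,1,4]), (16,f,[0,3,2,1,4]), (6,t,[4,1,2,3,0]),
    (15,t,[1,2,3,4,0]), (5,t,[1,3,4,2,0]), (5,t,[1,2,4,3,0]), (2,t,[4,1,2,3,0])],
    [(0,f,[1,2,4,0,3]), (1,f,[1,2,0,4,3]), (3,f,[1,0,2,4,3]), (4,f,[1,0,2,4,3]), (1,f,[1,4,0,2,3]),
    (2,f,[1,0,2,4,3]), (4,f,[1,0,4,2,3]), (6,f,[1,0,2,4,3]), (3,f,[2,0,1,4,3]), (4,f,[2,0,1,4,3]),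
    (12,f,[1,2,0,3,4]), (5,f,[1,2,0,3,4]), (12,f,[0,2,1,4,3]), (5,f,[0,2,1,4,3]),
    (14,f,[0,1,2,4,3]), (16,f,[0,1,2,4,3])],
    [(1,f,[2,4,0,1,3]), (2,f,[2,0,1,4,3]), (12,f,[0,1,2,4,3]), (5,f,[0,1,2,4,3]),
    (2,f,[4,0,1,2,3]), (10,t,[3,0,1,2,4]), (5,f,[0,1,4,2,3]), (8,t,[3,2,4,0,1]), (4,f,[2,0,4,1,3]),
    (6,f,[2,0,1,4,3]), (14,f,[0,2,1,4,3]), (16,f,[0,2,1,4,3]), (5,f,[0,2,4,1,3]),
    (8,t,[3,1,4,0,2]), (15,f,[0,1,2,4,3]), (6,t,[3,4,1,2,0])],
    [(3,f,[4,0,1,2,3]), (12,f,[0,4,1,2,3]), (12,f,[1,4,0,3,2]), (14,f,[0,1,4,2,3]),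
    (4,f,[4,0,1,2,3]), (5,f,[0,4,1,2,3]), (5,f,[1,4,0,3,2]), (16,f,[0,1,4,2,3]),
    (12,f,[2,4,0,3,1]), (14,f,[0,2,4,1,3]), (9,f,[0,1,2,4,3]), (15,t,[4,1,2,3,0]),
    (14,f,[0,4,2,1,3]), (15,f,[0,2,4,1,3]), (15,t,[2,1,4,3,0]), (5,t,[2,4,3,1,0])],
    [(4,f,[4,0,2,1,3]), (5,f,[0,4,2,1,3]), (14,f,[0,4,1,2,3]), (15,f,[0,1,4,2,3]),
    (6,f,[4,0,1,2,3]), (8,t,[3,1,2,0,4]), (16,f,[0,4,1,2,3]), (6,t,[3,2,1,4,0]), (5,f,[2,4,0,3,1]),
    (16,f,[0,2,4,1,3]), (15,t,[1,2,4,3,0]), (5,t,[1,4,3,2,0]), (16,f,[0,4,2,1,3]),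
    (6,t,[3,1,2,4,0]), (5,t,[1,2,3,4,0]), (2,t,[3,1,2,4,0])],
    [(1,f,[1,2,3,4,0]), (13,f,[1,2,0,3,4]), (4,f,[1,2,3,0,4]), (6,f,[1,2,0,3,4]),
    (4,f,[1,2,4,0,3]), (6,f,[1,2,0,4,3]), (7,f,[1,0,2,3,4]), (8,f,[1,0,2,3,4]), (4,f,[2,1,3,0,4]),
    (6,f,[2,1,0,3,4]), (5,f,[1,2,3,0,4]), (8,t,[4,0,3,1,2]), (14,f,[1,2,0,3,4]),
    (16,f,[1,2,0,3,4]), (15,f,[1,0,2,3,4]), (6,t,[4,3,0,2,1])],
    [(4,f,[2,1,4,0,3]), (6,f,[2,1,0,4,3]), (14,f,[1,2,0,4,3]), (16,f,[1,2,0,4,3]),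
    (5,f,[1,2,4,0,3]), (8,t,[3,0,4,1,2]), (15,f,[1,0,2,4,3]), (6,t,[3,4,0,2,1]), (7,f,[2,0,1,3,4]),
    (8,f,[2,0,1,3,4]), (15,f,[2,0,1,3,4]), (6,t,[4,3,0,1,2]), (15,f,[2,0,1,4,3]),
    (6,t,[3,4,0,1,2]), (9,t,[3,0,1,2,4]), (13,t,[3,4,0,1,2])],
    [(12,f,[3,4,1,2,0]), (9,f,[1,0,3,4,2]), (14,f,[1,3,4,0,2]), (15,t,[4,0,3,2,1]),
    (14,f,[1,4,3,0,2]), (15,t,[3,0,4,2,1]), (15,f,[1,3,4,0,2]), (5,t,[3,4,2,0,1]),
    (14,f,[2,3,4,0,1]), (15,t,[4,0,3,1,2]), (15,t,[4,1,2,0,3]), (7,t,[4,0,3,1,2]),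
    (17,f,[0,1,2,3,4]), (14,t,[3,4,0,2,1]), (14,t,[2,4,1,3,0]), (4,t,[4,2,3,1,0])],
    [(14,f,[2,4,3,0,1]), (15,t,[3,0,4,1,2]), (17,f,[0,1,2,4,3]), (14,t,[3,4,0,1,2]),
    (15,t,[3,1,2,0,4]), (7,t,[3,0,4,1,2]), (14,t,[2,3,1,4,0]), (4,t,[3,2,4,1,0]),
    (15,f,[2,3,4,0,1]), (5,t,[3,4,1,0,2]), (14,t,[1,4,2,3,0]), (4,t,[4,1,3,2,0]),
    (14,t,[1,3,2,4,0]), (4,t,[3,1,4,2,0]), (12,t,[1,2,3,4,0]), (1,t,[3,4,1,2,0])],
    [(0,f,[1,3,4,0,2]), (3,f,[1,0,3,4,2]), (1,f,[1,3,0,4,2]), (4,f,[1,0,3,4,2]), (1,f,[1,4,0,3,2]),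
    (4,f,[1,0,4,3,2]), (2,f,[1,0,3,4,2]), (6,f,[1,0,3,4,2]), (3,f,[3,0,1,4,2]), (12,f,[1,3,0,2,4]),
    (4,f,[3,0,1,4,2]), (5,f,[1,3,0,2,4]), (12,f,[0,3,1,4,2]), (14,f,[0,1,3,4,2]),
    (5,f,[0,3,1,4,2]), (16,f,[0,1,3,4,2])],
    [(3,f,[4,0,1,3,2]), (12,f,[1,4,0,2,3]), (12,f,[0,4,1,3,2]), (14,f,[0,1,4,3,2]),
    (4,f,[4,0,1,3,2]), (5,f,[1,4,0,2,3]), (5,f,[0,4,1,3,2]), (16,f,[0,1,4,3,2]),
    (12,f,[3,4,0,2,1]), (9,f,[0,1,3,4,2]), (14,f,[0,3,4,1,2]), (15,t,[4,1,3,2,0]),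
    (14,f,[0,4,3,1,2]), (15,t,[3,1,4,2,0]), (15,f,[0,3,4,1,2]), (5,t,[3,4,2,1,0])],
    [(1,f,[3,4,0,1,2]), (12,f,[0,1,3,4,2]), (2,f,[3,0,1,4,2]), (5,f,[0,1,3,4,2]),
    (2,f,[4,0,1,3,2]), (5,f,[0,1,4,3,2]), (10,t,[2,0,1,3,4]), (8,t,[2,3,4,0,1]), (4,f,[3,0,4,1,2]),
    (14,f,[0,3,1,4,2]), (6,f,[3,0,1,4,2]), (16,f,[0,3,1,4,2]), (5,f,[0,3,4,1,2]),
    (15,f,[0,1,3,4,2]), (8,t,[2,1,4,0,3]), (6,t,[2,4,1,3,0])],
    [(4,f,[4,0,3,1,2]), (14,f,[0,4,1,3,2]), (5,f,[0,4,3,1,2]), (15,f,[0,1,4,3,2]),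
    (6,f,[4,0,1,3,2]), (16,f,[0,4,1,3,2]), (8,t,[2,1,3,0,4]), (6,t,[2,3,1,4,0]), (5,f,[3,4,0,2,1]),
    (15,t,[1,3,4,2,0]), (16,f,[0,3,4,1,2]), (5,t,[1,4,2,3,0]), (16,f,[0,4,3,1,2]),
    (5,t,[1,3,2,4,0]), (6,t,[2,1,3,4,0]), (2,t,[2,1,3,4,0])],
    [(1,f,[1,3,2,4,0]), (4,f,[1,2,3,4,0]), (13,f,[1,3,0,2,4]), (6,f,[1,3,0,2,4]),
    (4,f,[1,3,4,0,2]), (7,f,[1,0,3,2,4]), (6,f,[1,3,0,4,2]), (8,f,[1,0,3,2,4]), (4,f,[3,1,2,0,4]),
    (5,f,[1,3,2,0,4]), (6,f,[3,1,0,2,4]), (8,t,[4,0,2,1,3]), (14,f,[1,3,0,2,4]),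
    (15,f,[1,0,3,2,4]), (16,f,[1,3,0,2,4]), (6,t,[4,2,0,3,1])],
    [(12,f,[2,4,1,3,0]), (14,f,[1,2,4,0,3]), (9,f,[1,0,2,4,3]), (15,t,[4,0,2,3,1]),
    (14,f,[1,4,2,0,3]), (15,f,[1,2,4,0,3]), (15,t,[2,0,4,3,1]), (5,t,[2,4,3,0,1]),
    (14,f,[2,3,4,1,0]), (15,t,[4,1,3,0,2]), (15,t,[4,0,2,1,3]), (7,t,[4,0,2,1,3]),
    (17,f,[0,1,3,2,4]), (14,t,[3,4,1,2,0]), (14,t,[2,4,0,3,1]), (4,t,[4,2,3,0,1])],
    [(4,f,[3,1,4,0,2]), (14,f,[1,3,0,4,2]), (6,f,[3,1,0,4,2]), (16,f,[1,3,0,4,2]),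
    (5,f,[1,3,4,0,2]), (15,f,[1,0,3,4,2]), (8,t,[2,0,4,1,3]), (6,t,[2,4,0,3,1]), (7,f,[3,0,1,2,4]),
    (15,f,[3,0,1,2,4]), (8,f,[3,0,1,2,4]), (6,t,[4,2,0,1,3]), (15,f,[3,0,1,4,2]),
    (9,t,[2,0,1,3,4]), (6,t,[2,4,0,1,3]), (13,t,[2,4,0,1,3])],
    [(14,f,[3,4,2,0,1]), (17,f,[0,1,3,4,2]), (15,t,[2,0,4,1,3]), (14,t,[2,4,0,1,3]),
    (15,t,[2,1,3,0,4]), (14,t,[2,3,1,0,4]), (7,t,[2,0,4,1,3]), (4,t,[2,3,4,1,0]),
    (15,f,[3,2,4,0,1]), (14,t,[1,4,3,2,0]), (5,t,[2,4,1,0,3]), (4,t,[4,1,2,3,0]),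
    (14,t,[1,2,3,4,0]), (12,t,[1,3,2,4,0]), (4,t,[2,1,4,3,0]), (1,t,[2,4,1,3,0])],
    [(1,f,[1,4,2,3,0]), (4,f,[1,2,4,3,0]), (4,f,[1,3,4,2,0]), (7,f,[1,0,4,2,3]),
    (13,f,[1,4,0,2,3]), (6,f,[1,4,0,2,3]), (6,f,[1,4,0,3,2]), (8,f,[1,0,4,2,3]),
    (12,f,[2,3,1,4,0]), (14,f,[1,2,3,0,4]), (14,f,[1,3,2,0,4]), (15,f,[1,2,3,0,4]),
    (9,f,[1,0,2,3,4]), (15,t,[3,0,2,4,1]), (15,t,[2,0,3,4,1]), (5,t,[2,3,4,0,1])],
    [(4,f,[4,1,2,0,3]), (5,f,[1,4,2,0,3]), (14,f,[1,4,0,2,3]), (15,f,[1,0,4,2,3]),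
    (6,f,[4,1,0,2,3]), (8,t,[3,0,2,1,4]), (16,f,[1,4,0,2,3]), (6,t,[3,2,0,4,1]),
    (14,f,[2,4,3,1,0]), (15,t,[3,1,4,0,2]), (17,f,[0,1,4,2,3]), (14,t,[3,4,1,0,2]),
    (15,t,[3,0,2,1,4]), (7,t,[3,0,2,1,4]), (14,t,[2,3,0,4,1]), (4,t,[3,2,4,0,1])],
    [(4,f,[4,1,3,0,2]), (14,f,[1,4,0,3,2]), (5,f,[1,4,3,0,2]), (15,f,[1,0,4,3,2]),
    (6,f,[4,1,0,3,2]), (16,f,[1,4,0,3,2]), (8,t,[2,0,3,1,4]), (6,t,[2,3,0,4,1]),
    (14,f,[3,4,2,1,0]), (17,f,[0,1,4,3,2]), (15,t,[2,1,4,0,3]), (14,t,[2,4,1,0,3]),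
    (15,t,[2,0,3,1,4]), (14,t,[2,3,0,1,4]), (7,t,[2,0,3,1,4]), (4,t,[2,3,4,0,1])],
    [(7,f,[4,0,1,2,3]), (15,f,[4,0,1,2,3]), (15,f,[4,0,1,3,2]), (9,t,[2,0,1,4,3]),
    (8,f,[4,0,1,2,3]), (6,t,[3,2,0,1,4]), (6,t,[2,3,0,1,4]), (13,t,[2,3,0,1,4]),
    (15,f,[4,2,3,0,1]), (14,t,[1,3,4,2,0]), (14,t,[1,2,4,3,0]), (12,t,[1,4,2,3,0]),
    (5,t,[2,3,1,0,4]), (4,t,[3,1,2,4,0]), (4,t,[2,1,3,4,0]), (1,t,[2,3,1,4,0])],
    [(2,f,[1,2,3,4,0]), (6,f,[1,2,3,4,0]), (6,f,[1,3,2,4,0]), (8,f,[1,2,3,0,4]), (6,f,[1,4,2,3,0]),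
    (8,f,[1,2,4,0,3]), (8,f,[1,3,4,0,2]), (10,f,[1,0,2,3,4]), (5,f,[2,3,1,4,0]),
    (16,t,[0,4,3,2,1]), (16,t,[0,4,2,3,1]), (6,t,[4,0,2,3,1]), (15,t,[0,2,3,4,1]),
    (5,t,[0,3,4,2,1]), (5,t,[0,2,4,3,1]), (2,t,[4,0,2,3,1])],
    [(5,f,[2,4,1,3,0]), (16,t,[0,3,4,2,1]), (15,t,[0,2,4,3,1]), (5,t,[0,4,3,2,1]),
    (16,t,[0,3,2,4,1]), (6,t,[3,0,2,4,1]), (5,t,[0,2,3,4,1]), (2,t,[3,0,2,4,1]),
    (15,f,[2,3,4,1,0]), (5,t,[3,4,0,1,2]), (14,t,[0,4,2,3,1]), (4,t,[4,0,3,2,1]),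
    (14,t,[0,3,2,4,1]), (4,t,[3,0,4,2,1]), (12,t,[0,2,3,4,1]), (1,t,[3,4,0,2,1])],
    [(5,f,[3,4,1,2,0]), (15,t,[0,3,4,2,1]), (16,t,[0,2,4,3,1]), (5,t,[0,4,2,3,1]),
    (16,t,[0,2,3,4,1]), (5,t,[0,3,2,4,1]), (6,t,[2,0,3,4,1]), (2,t,[2,0,3,4,1]),
    (15,f,[3,2,4,1,0]), (14,t,[0,4,3,2,1]), (5,t,[2,4,0,1,3]), (4,t,[4,0,2,3,1]),
    (14,t,[0,2,3,4,1]), (12,t,[0,3,2,4,1]), (4,t,[2,0,4,3,1]), (1,t,[2,4,0,3,1])],
    [(15,f,[4,2,3,1,0]), (14,t,[0,3,4,2,1]), (14,t,[0,2,4,3,1]), (12,t,[0,4,2,3,1]),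
    (5,t,[2,3,0,1,4]), (4,t,[3,0,2,4,1]), (4,t,[2,0,3,4,1]), (1,t,[2,3,0,4,1]), (9,t,[0,2,3,4,1]),
    (12,t,[3,4,0,1,2]), (12,t,[2,4,0,1,3]), (3,t,[4,0,2,3,1]), (12,t,[2,3,0,1,4]),
    (3,t,[3,0,2,4,1]), (3,t,[2,0,3,4,1]), (0,t,[2,3,4,0,1])],
    [(0,f,[2,3,4,0,1]), (3,f,[2,0,3,4,1]), (3,f,[3,0,2,4,1]), (12,f,[2,3,0,1,4]),
    (3,f,[4,0,2,3,1]), (12,f,[2,4,0,1,3]), (12,f,[3,4,0,1,2]), (9,f,[0,2,3,4,1]),
    (1,f,[2,3,0,4,1]), (4,f,[2,0,3,4,1]), (4,f,[3,0,2,4,1]), (5,f,[2,3,0,1,4]), (12,f,[0,4,2,3,1]),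
    (14,f,[0,2,4,3,1]), (14,f,[0,3,4,2,1]), (15,t,[4,2,3,1,0])],
    [(1,f,[2,4,0,3,1]), (4,f,[2,0,4,3,1]), (12,f,[0,3,2,4,1]), (14,f,[0,2,3,4,1]),
    (4,f,[4,0,2,3,1]), (5,f,[2,4,0,1,3]), (14,f,[0,4,3,2,1]), (15,t,[3,2,4,1,0]),
    (2,f,[2,0,3,4,1]), (6,f,[2,0,3,4,1]), (5,f,[0,3,2,4,1]), (16,f,[0,2,3,4,1]), (5,f,[0,4,2,3,1]),
    (16,f,[0,2,4,3,1]), (15,f,[0,3,4,2,1]), (5,t,[3,4,1,2,0])],
    [(1,f,[3,4,0,2,1]), (12,f,[0,2,3,4,1]), (4,f,[3,0,4,2,1]), (14,f,[0,3,2,4,1]),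
    (4,f,[4,0,3,2,1]), (14,f,[0,4,2,3,1]), (5,f,[3,4,0,1,2]), (15,t,[2,3,4,1,0]),
    (2,f,[3,0,2,4,1]), (5,f,[0,2,3,4,1]), (6,f,[3,0,2,4,1]), (16,f,[0,3,2,4,1]), (5,f,[0,4,3,2,1]),
    (15,f,[0,2,4,3,1]), (16,f,[0,3,4,2,1]), (5,t,[2,4,1,3,0])],
    [(2,f,[4,0,2,3,1]), (5,f,[0,2,4,3,1]), (5,f,[0,3,4,2,1]), (15,f,[0,2,3,4,1]),
    (6,f,[4,0,2,3,1]), (16,f,[0,4,2,3,1]), (16,f,[0,4,3,2,1]), (5,t,[2,3,1,4,0]),
    (10,t,[1,0,2,3,4]), (8,t,[1,3,4,0,2]), (8,t,[1,2,4,0,3]), (6,t,[1,4,2,3,0]), (8,t,[1,2,3,0,4]),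
    (6,t,[1,3,2,4,0]), (6,t,[1,2,3,4,0]), (2,t,[1,2,3,4,0])],
    [(1,f,[2,3,1,4,0]), (4,f,[2,1,3,4,0]), (4,f,[3,1,2,4,0]), (5,f,[2,3,1,0,4]),
    (12,f,[1,4,2,3,0]), (14,f,[1,2,4,3,0]), (14,f,[1,3,4,2,0]), (15,t,[4,2,3,0,1]),
    (13,f,[2,3,0,1,4]), (6,f,[2,3,0,1,4]), (6,f,[3,2,0,1,4]), (8,t,[4,0,1,2,3]), (9,f,[2,0,1,4,3]),
    (15,t,[4,0,1,3,2]), (15,t,[4,0,1,2,3]), (7,t,[4,0,1,2,3])],
    [(4,f,[2,3,4,0,1]), (7,f,[2,0,3,1,4]), (14,f,[2,3,0,1,4]), (15,f,[2,0,3,1,4]),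
    (14,f,[2,4,1,0,3]), (15,f,[2,1,4,0,3]), (17,t,[0,1,4,3,2]), (14,t,[3,4,2,1,0]),
    (6,f,[2,3,0,4,1]), (8,f,[2,0,3,1,4]), (16,t,[1,4,0,3,2]), (6,t,[4,1,0,3,2]),
    (15,t,[1,0,4,3,2]), (5,t,[1,4,3,0,2]), (14,t,[1,4,0,3,2]), (4,t,[4,1,3,0,2])],
    [(4,f,[3,2,4,0,1]), (14,f,[2,3,0,4,1]), (7,f,[3,0,2,1,4]), (15,f,[3,0,2,1,4]),
    (14,f,[3,4,1,0,2]), (17,t,[0,1,4,2,3]), (15,f,[3,1,4,0,2]), (14,t,[2,4,3,1,0]),
    (6,f,[3,2,0,4,1]), (16,t,[1,4,0,2,3]), (8,f,[3,0,2,1,4]), (6,t,[4,1,0,2,3]),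
    (15,t,[1,0,4,2,3]), (14,t,[1,4,0,2,3]), (5,t,[1,4,2,0,3]), (4,t,[4,1,2,0,3])],
    [(5,f,[2,3,4,0,1]), (15,f,[2,0,3,4,1]), (15,f,[3,0,2,4,1]), (9,t,[1,0,2,3,4]),
    (15,t,[1,2,3,0,4]), (14,t,[1,3,2,0,4]), (14,t,[1,2,3,0,4]), (12,t,[2,3,1,4,0]),
    (8,t,[1,0,4,2,3]), (6,t,[1,4,0,3,2]), (6,t,[1,4,0,2,3]), (13,t,[1,4,0,2,3]), (7,t,[1,0,4,2,3]),
    (4,t,[1,3,4,2,0]), (4,t,[1,2,4,3,0]), (1,t,[1,4,2,3,0])],
    [(1,f,[2,4,1,3,0]), (4,f,[2,1,4,3,0]), (12,f,[1,3,2,4,0]), (14,f,[1,2,3,4,0]),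
    (4,f,[4,1,2,3,0]), (5,f,[2,4,1,0,3]), (14,f,[1,4,3,2,0]), (15,t,[3,2,4,0,1]),
    (4,f,[2,3,4,1,0]), (7,f,[2,0,4,1,3]), (14,f,[2,3,1,0,4]), (15,f,[2,1,3,0,4]),
    (14,f,[2,4,0,1,3]), (15,f,[2,0,4,1,3]), (17,t,[0,1,3,4,2]), (14,t,[3,4,2,0,1])],
    [(13,f,[2,4,0,1,3]), (6,f,[2,4,0,1,3]), (9,f,[2,0,1,3,4]), (15,t,[3,0,1,4,2]),
    (6,f,[4,2,0,1,3]), (8,t,[3,0,1,2,4]), (15,t,[3,0,1,2,4]), (7,t,[3,0,1,2,4]), (6,f,[2,4,0,3,1]),
    (8,f,[2,0,4,1,3]), (15,t,[1,0,3,4,2]), (5,t,[1,3,4,0,2]), (16,t,[1,3,0,4,2]),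
    (6,t,[3,1,0,4,2]), (14,t,[1,3,0,4,2]), (4,t,[3,1,4,0,2])],
    [(4,f,[4,2,3,0,1]), (14,f,[2,4,0,3,1]), (14,f,[3,4,1,2,0]), (17,t,[0,1,3,2,4]),
    (7,f,[4,0,2,1,3]), (15,f,[4,0,2,1,3]), (15,f,[4,1,3,0,2]), (14,t,[2,3,4,1,0]),
    (5,f,[2,4,3,0,1]), (15,f,[2,0,4,3,1]), (15,t,[1,2,4,0,3]), (14,t,[1,4,2,0,3]),
    (15,f,[4,0,2,3,1]), (9,t,[1,0,2,4,3]), (14,t,[1,2,4,0,3]), (12,t,[2,4,1,3,0])],
    [(6,f,[4,2,0,3,1]), (16,t,[1,3,0,2,4]), (15,t,[1,0,3,2,4]), (14,t,[1,3,0,2,4]),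
    (8,f,[4,0,2,1,3]), (6,t,[3,1,0,2,4]), (5,t,[1,3,2,0,4]), (4,t,[3,1,2,0,4]), (8,t,[1,0,3,2,4]),
    (6,t,[1,3,0,4,2]), (7,t,[1,0,3,2,4]), (4,t,[1,3,4,0,2]), (6,t,[1,3,0,2,4]), (13,t,[1,3,0,2,4]),
    (4,t,[1,2,3,4,0]), (1,t,[1,3,2,4,0])],
    [(2,f,[2,1,3,4,0]), (6,f,[2,1,3,4,0]), (5,f,[1,3,2,4,0]), (16,t,[0,4,3,1,2]),
    (5,f,[1,4,2,3,0]), (16,t,[0,3,4,1,2]), (15,f,[1,3,4,2,0]), (5,t,[3,4,0,2,1]),
    (6,f,[2,3,1,4,0]), (8,f,[2,1,3,0,4]), (16,t,[0,4,1,3,2]), (6,t,[4,0,1,3,2]),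
    (15,t,[0,1,4,3,2]), (5,t,[0,4,3,1,2]), (14,t,[0,4,1,3,2]), (4,t,[4,0,3,1,2])],
    [(6,f,[2,4,1,3,0]), (8,f,[2,1,4,0,3]), (15,t,[0,1,3,4,2]), (5,t,[0,3,4,1,2]),
    (16,t,[0,3,1,4,2]), (6,t,[3,0,1,4,2]), (14,t,[0,3,1,4,2]), (4,t,[3,0,4,1,2]),
    (8,f,[2,3,4,0,1]), (10,f,[2,0,1,3,4]), (5,t,[0,1,4,3,2]), (2,t,[4,0,1,3,2]), (5,t,[0,1,3,4,2]),
    (2,t,[3,0,1,4,2]), (12,t,[0,1,3,4,2]), (1,t,[3,4,0,1,2])],
    [(5,f,[3,4,2,1,0]), (15,t,[0,3,4,1,2]), (15,f,[3,1,4,2,0]), (14,t,[0,4,3,1,2]),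
    (15,f,[4,1,3,2,0]), (14,t,[0,3,4,1,2]), (9,t,[0,1,3,4,2]), (12,t,[3,4,0,2,1]),
    (16,t,[0,1,4,3,2]), (5,t,[0,4,1,3,2]), (5,t,[1,4,0,2,3]), (4,t,[4,0,1,3,2]),
    (14,t,[0,1,4,3,2]), (12,t,[0,4,1,3,2]), (12,t,[1,4,0,2,3]), (3,t,[4,0,1,3,2])],
    [(16,t,[0,1,3,4,2]), (5,t,[0,3,1,4,2]), (14,t,[0,1,3,4,2]), (12,t,[0,3,1,4,2]),
    (5,t,[1,3,0,2,4]), (4,t,[3,0,1,4,2]), (12,t,[1,3,0,2,4]), (3,t,[3,0,1,4,2]), (6,t,[1,0,3,4,2]),
    (2,t,[1,0,3,4,2]), (4,t,[1,0,4,3,2]), (1,t,[1,4,0,3,2]), (4,t,[1,0,3,4,2]), (1,t,[1,3,0,4,2]),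
    (3,t,[1,0,3,4,2]), (0,t,[1,3,4,0,2])],
    [(1,f,[3,4,1,2,0]), (12,f,[1,2,3,4,0]), (4,f,[3,1,4,2,0]), (14,f,[1,3,2,4,0]),
    (4,f,[4,1,3,2,0]), (14,f,[1,4,2,3,0]), (5,f,[3,4,1,0,2]), (15,t,[2,3,4,0,1]),
    (4,f,[3,2,4,1,0]), (14,f,[2,3,1,4,0]), (7,f,[3,0,4,1,2]), (15,f,[3,1,2,0,4]),
    (14,f,[3,4,0,1,2]), (17,t,[0,1,2,4,3]), (15,f,[3,0,4,1,2]), (14,t,[2,4,3,0,1])],
    [(4,f,[4,2,3,1,0]), (14,f,[2,4,1,3,0]), (14,f,[3,4,0,2,1]), (17,t,[0,1,2,3,4]),
    (7,f,[4,0,3,1,2]), (15,f,[4,1,2,0,3]), (15,f,[4,0,3,1,2]), (14,t,[2,3,4,0,1]),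
    (5,f,[3,4,2,0,1]), (15,t,[1,3,4,0,2]), (15,f,[3,0,4,2,1]), (14,t,[1,4,3,0,2]),
    (15,f,[4,0,3,2,1]), (14,t,[1,3,4,0,2]), (9,t,[1,0,3,4,2]), (12,t,[3,4,1,2,0])],
    [(13,f,[3,4,0,1,2]), (9,f,[3,0,1,2,4]), (6,f,[3,4,0,1,2]), (15,t,[2,0,1,4,3]),
    (6,f,[4,3,0,1,2]), (15,t,[2,0,1,3,4]), (8,t,[2,0,1,3,4]), (7,t,[2,0,1,3,4]), (6,f,[3,4,0,2,1]),
    (15,t,[1,0,2,4,3]), (8,f,[3,0,4,1,2]), (5,t,[1,2,4,0,3]), (16,t,[1,2,0,4,3]),
    (14,t,[1,2,0,4,3]), (6,t,[2,1,0,4,3]), (4,t,[2,1,4,0,3])],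
    [(6,f,[4,3,0,2,1]), (15,t,[1,0,2,3,4]), (16,t,[1,2,0,3,4]), (14,t,[1,2,0,3,4]),
    (8,f,[4,0,3,1,2]), (5,t,[1,2,3,0,4]), (6,t,[2,1,0,3,4]), (4,t,[2,1,3,0,4]), (8,t,[1,0,2,3,4]),
    (7,t,[1,0,2,3,4]), (6,t,[1,2,0,4,3]), (4,t,[1,2,4,0,3]), (6,t,[1,2,0,3,4]), (4,t,[1,2,3,0,4]),
    (13,t,[1,2,0,3,4]), (1,t,[1,2,3,4,0])],
    [(2,f,[3,1,2,4,0]), (5,f,[1,2,3,4,0]), (6,f,[3,1,2,4,0]), (16,t,[0,4,2,1,3]),
    (5,f,[1,4,3,2,0]), (15,f,[1,2,4,3,0]), (16,t,[0,2,4,1,3]), (5,t,[2,4,0,3,1]),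
    (6,f,[3,2,1,4,0]), (16,t,[0,4,1,2,3]), (8,f,[3,1,2,0,4]), (6,t,[4,0,1,2,3]),
    (15,t,[0,1,4,2,3]), (14,t,[0,4,1,2,3]), (5,t,[0,4,2,1,3]), (4,t,[4,0,2,1,3])],
    [(5,f,[2,4,3,1,0]), (15,f,[2,1,4,3,0]), (15,t,[0,2,4,1,3]), (14,t,[0,4,2,1,3]),
    (15,f,[4,1,2,3,0]), (9,t,[0,1,2,4,3]), (14,t,[0,2,4,1,3]), (12,t,[2,4,0,3,1]),
    (16,t,[0,1,4,2,3]), (5,t,[1,4,0,3,2]), (5,t,[0,4,1,2,3]), (4,t,[4,0,1,2,3]),
    (14,t,[0,1,4,2,3]), (12,t,[1,4,0,3,2]), (12,t,[0,4,1,2,3]), (3,t,[4,0,1,2,3])],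
    [(6,f,[3,4,1,2,0]), (15,t,[0,1,2,4,3]), (8,f,[3,1,4,0,2]), (5,t,[0,2,4,1,3]),
    (16,t,[0,2,1,4,3]), (14,t,[0,2,1,4,3]), (6,t,[2,0,1,4,3]), (4,t,[2,0,4,1,3]),
    (8,f,[3,2,4,0,1]), (5,t,[0,1,4,2,3]), (10,f,[3,0,1,2,4]), (2,t,[4,0,1,2,3]), (5,t,[0,1,2,4,3]),
    (12,t,[0,1,2,4,3]), (2,t,[2,0,1,4,3]), (1,t,[2,4,0,1,3])],
    [(16,t,[0,1,2,4,3]), (14,t,[0,1,2,4,3]), (5,t,[0,2,1,4,3]), (12,t,[0,2,1,4,3]),
    (5,t,[1,2,0,3,4]), (12,t,[1,2,0,3,4]), (4,t,[2,0,1,4,3]), (3,t,[2,0,1,4,3]), (6,t,[1,0,2,4,3]),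
    (4,t,[1,0,4,2,3]), (2,t,[1,0,2,4,3]), (1,t,[1,4,0,2,3]), (4,t,[1,0,2,4,3]), (3,t,[1,0,2,4,3]),
    (1,t,[1,2,0,4,3]), (0,t,[1,2,4,0,3])],
    [(2,f,[4,1,2,3,0]), (5,f,[1,2,4,3,0]), (5,f,[1,3,4,2,0]), (15,f,[1,2,3,4,0]),
    (6,f,[4,1,2,3,0]), (16,t,[0,3,2,1,4]), (16,t,[0,2,3,1,4]), (5,t,[2,3,0,4,1]),
    (5,f,[2,3,4,1,0]), (15,f,[2,1,3,4,0]), (15,f,[3,1,2,4,0]), (9,t,[0,1,2,3,4]),
    (15,t,[0,2,3,1,4]), (14,t,[0,3,2,1,4]), (14,t,[0,2,3,1,4]), (12,t,[2,3,0,4,1])],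
    [(6,f,[4,2,1,3,0]), (16,t,[0,3,1,2,4]), (15,t,[0,1,3,2,4]), (14,t,[0,3,1,2,4]),
    (8,f,[4,1,2,0,3]), (6,t,[3,0,1,2,4]), (5,t,[0,3,2,1,4]), (4,t,[3,0,2,1,4]), (16,t,[0,1,3,2,4]),
    (5,t,[1,3,0,4,2]), (14,t,[0,1,3,2,4]), (12,t,[1,3,0,4,2]), (5,t,[0,3,1,2,4]),
    (4,t,[3,0,1,2,4]), (12,t,[0,3,1,2,4]), (3,t,[3,0,1,2,4])],
    [(6,f,[4,3,1,2,0]), (15,t,[0,1,2,3,4]), (16,t,[0,2,1,3,4]), (14,t,[0,2,1,3,4]),
    (8,f,[4,1,3,0,2]), (5,t,[0,2,3,1,4]), (6,t,[2,0,1,3,4]), (4,t,[2,0,3,1,4]), (16,t,[0,1,2,3,4]),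
    (14,t,[0,1,2,3,4]), (5,t,[1,2,0,4,3]), (12,t,[1,2,0,4,3]), (5,t,[0,2,1,3,4]),
    (12,t,[0,2,1,3,4]), (4,t,[2,0,1,3,4]), (3,t,[2,0,1,3,4])],
    [(8,f,[4,2,3,0,1]), (5,t,[0,1,3,2,4]), (5,t,[0,1,2,3,4]), (12,t,[0,1,2,3,4]),
    (10,f,[4,0,1,2,3]), (2,t,[3,0,1,2,4]), (2,t,[2,0,1,3,4]), (1,t,[2,3,0,1,4]), (6,t,[1,0,2,3,4]),
    (4,t,[1,0,3,2,4]), (4,t,[1,0,2,3,4]), (3,t,[1,0,2,3,4]), (2,t,[1,0,2,3,4]), (1,t,[1,3,0,2,4]),
    (1,t,[1,2,0,3,4]), (0,t,[1,2,3,0,4])],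
    [(10,t,[0,1,2,3,4]), (8,t,[0,3,4,1,2]), (8,t,[0,2,4,1,3]), (6,t,[0,4,2,3,1]),
    (8,t,[0,2,3,1,4]), (6,t,[0,3,2,4,1]), (6,t,[0,2,3,4,1]), (2,t,[0,2,3,4,1]), (8,t,[0,1,4,2,3]),
    (6,t,[0,4,1,3,2]), (6,t,[0,4,1,2,3]), (13,t,[0,4,1,2,3]), (7,t,[0,1,4,2,3]), (4,t,[0,3,4,2,1]),
    (4,t,[0,2,4,3,1]), (1,t,[0,4,2,3,1])],
    [(8,t,[0,1,3,2,4]), (6,t,[0,3,1,4,2]), (7,t,[0,1,3,2,4]), (4,t,[0,3,4,1,2]), (6,t,[0,3,1,2,4]),
    (13,t,[0,3,1,2,4]), (4,t,[0,2,3,4,1]), (1,t,[0,3,2,4,1]), (6,t,[0,1,3,4,2]), (2,t,[0,1,3,4,2]),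
    (4,t,[0,1,4,3,2]), (1,t,[0,4,1,3,2]), (4,t,[0,1,3,4,2]), (1,t,[0,3,1,4,2]), (3,t,[0,1,3,4,2]),
    (0,t,[0,3,4,1,2])],
    [(8,t,[0,1,2,3,4]), (7,t,[0,1,2,3,4]), (6,t,[0,2,1,4,3]), (4,t,[0,2,4,1,3]), (6,t,[0,2,1,3,4]),
    (4,t,[0,2,3,1,4]), (13,t,[0,2,1,3,4]), (1,t,[0,2,3,4,1]), (6,t,[0,1,2,4,3]), (4,t,[0,1,4,2,3]),
    (2,t,[0,1,2,4,3]), (1,t,[0,4,1,2,3]), (4,t,[0,1,2,4,3]), (3,t,[0,1,2,4,3]), (1,t,[0,2,1,4,3]),
    (0,t,[0,2,4,1,3])],
    [(6,t,[0,1,2,3,4]), (4,t,[0,1,3,2,4]), (4,t,[0,1,2,3,4]), (3,t,[0,1,2,3,4]), (2,t,[0,1,2,3,4]),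
    (1,t,[0,3,1,2,4]), (1,t,[0,2,1,3,4]), (0,t,[0,2,3,1,4]), (13,t,[0,1,2,3,4]), (1,t,[0,1,3,4,2]),
    (1,t,[0,1,2,4,3]), (0,t,[0,1,4,2,3]), (1,t,[0,1,2,3,4]), (0,t,[0,1,3,2,4]), (0,t,[0,1,2,3,4]),
    (11,t,[0,1,2,3,4])]])"

section \<open>Executable gains and the normalised case check\<close>

definition type_index :: "bool list \<Rightarrow> nat option" where
  "type_index T = find (\<lambda>i. types ! i = T) [0..<11]"

definition form_at :: "nat \<Rightarrow> bool list \<Rightarrow> bool list \<Rightarrow> int" where
  "form_at i p q = (case vectors ! i of (w, vs) \<Rightarrow>
     int w * (\<Sum>v\<leftarrow>map (trie_of 5 \<circ> map Leaf) vs. lookup v p * lookup v q))"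

text \<open>Being 0 on every colouring that is not literally a representative with vectors makes the
  sum over relabellings sparse; \<open>hits\<close> lists the surviving terms.\<close>

definition form :: "bool list \<Rightarrow> bool list \<Rightarrow> bool list \<Rightarrow> int" where
  "form T p q = (case type_index T of None \<Rightarrow> 0 | Some i \<Rightarrow> form_at i p q)"

definition k4_type :: "bool list \<Rightarrow> int" where
  "k4_type T = (\<Sum>\<pi>\<leftarrow>[[1,2,3,4],[0,2,3,4],[0,1,3,4],[0,1,2,4],[0,1,2,3]].
     of_bool (relabel False \<pi> T = replicate 6 True \<or> relabel False \<pi> T = replicate 6 False))"

definition relabellings :: "(bool \<times> nat list) list" where
  "relabellings = List.product [False, True] (permutations_of_set_list [0,1,2,3,4])"

text \<open>
  The weight \<open>230400 = 48 \<cdot> 4800\<close> of a monochromatic \<open>K\<^sub>4\<close> reflects the scaling of the vectors;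
  the summand \<open>2500000\<close> only keeps all tabulated numbers positive.
\<close>

definition gain :: "bool list \<Rightarrow> bool list \<Rightarrow> bool list \<Rightarrow> int" where
  "gain T p q = 2500000 + 230400 * k4_type T
     - (\<Sum>(b,\<pi>)\<leftarrow>relabellings. form (relabel b \<pi> T) (act b \<pi> p) (act b \<pi> q))"

text \<open>The first six bits select one of 64 rows, the last four one of its 16 entries.\<close>

definition canon :: "(nat \<times> bool \<times> nat list) trie" where
  "canon = trie_of 6 (map (trie_of 4 \<circ> map Leaf) canon_table)"

definition gain_bits :: "nat \<Rightarrow> bool list \<Rightarrow> int" where
  "gain_bits j bs = gain (types ! j) (take 5 bs) (drop 5 bs)"

text \<open>Depends on the type alone, so the 240 relabellings are filtered once per type and not
  once per pair of patterns.\<close>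

definition hits :: "bool list \<Rightarrow> (bool \<times> nat list \<times> nat) list" where
  "hits T = concat (map (\<lambda>(b, \<pi>). case type_index (relabel b \<pi> T) of
     None \<Rightarrow> [] | Some i \<Rightarrow> [(b, \<pi>, i)]) relabellings)"

fun canon_gain_of :: "nat \<times> bool \<times> nat list \<Rightarrow> bool list \<Rightarrow> bool list \<Rightarrow> int" where
  "canon_gain_of (j, b, \<pi>) p q = gain_bits j (act b \<pi> p @ act b \<pi> q)"

text \<open>The gain is evaluated at the representative, so the 18 types suffice in place of all
  1024 colourings.\<close>

definition canon_gain :: "bool list \<Rightarrow> bool list \<Rightarrow> bool list \<Rightarrow> int" where
  "canon_gain T p q = canon_gain_of (lookup canon T) p q"

primrec all_bits :: "nat \<Rightarrow> (bool list \<Rightarrow> bool) \<Rightarrow> bool list \<Rightarrow> bool" where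
  "all_bits 0 P pre = P pre"
| "all_bits (Suc n) P pre = (all_bits n P (pre @ [False]) \<and> all_bits n P (pre @ [True]))"

lemma all_bitsD: "all_bits n P pre \<Longrightarrow> length bs = n \<Longrightarrow> P (pre @ bs)"
proof (induction n arbitrary: bs pre)
  case (Suc n)
  then obtain b bs' where bs: "bs = b # bs'" "length bs' = n" by (auto simp: length_Suc_conv)
  have "all_bits n P (pre @ [b])" using Suc.prems(1) by (cases b) simp_all
  from Suc.IH[OF this bs(2)] show ?case by (simp add: bs(1))
qed simp

text \<open>
  A 7-set is listed as five vertices of colouring \<open>T\<close>, a sixth vertex with pattern \<open>p\<close>, and a seventh
  one with pattern \<open>q\<close> to the first six. Choosing the seventh vertex among the vertices of largest
  imbalance, and then the sixth one likewise in the rest, leaves few cases. The threshold is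
  \<open>53196000 = 21 \<cdot> 2500000 + 696000\<close>.
\<close>

fun canon_check :: "nat \<times> bool \<times> nat list \<Rightarrow> bool list \<Rightarrow> bool" where
  "canon_check (j, b, \<pi>) T \<longleftrightarrow>
     j < 18 \<and> length \<pi> = 5 \<and> distinct \<pi> \<and> list_all (\<lambda>i. i < 5) \<pi> \<and> relabel b \<pi> T = types ! j"

definition canon_ok :: "bool list \<Rightarrow> bool" where
  "canon_ok T = canon_check (lookup canon T) T"

text \<open>Vertex 5 has pattern \<open>p\<close> and vertex 6 has pattern \<open>q\<close>. Since
  \<open>q\<close> is consulted for vertex 6 only, \<open>q = []\<close> describes the colouring of
  the first six vertices.\<close>

definition rel7 :: "bool list \<Rightarrow> bool list \<Rightarrow> bool list \<Rightarrow> nat \<Rightarrow> nat \<Rightarrow> bool" where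
  "rel7 T p q i j = (if max i j = 6 then q ! min i j else if max i j = 5 then p ! min i j else rel T i j)"

text \<open>The difference of the two colour degrees. It is invariant under reordering and under
  exchange of the colours, so extremality survives the passage to a representative.\<close>

definition imbalance :: "bool list \<Rightarrow> int" where
  "imbalance bs = \<bar>2 * int (count_list bs True) - int (length bs)\<bar>"

text \<open>Each of the 21 unordered pairs serves once as the two extra vertices; their order is
  immaterial by \<open>excess_commute\<close>.\<close>

definition total_gain :: "bool list \<Rightarrow> bool list \<Rightarrow> bool list \<Rightarrow> int" where
  "total_gain T p q = (\<Sum>(k, l)\<leftarrow>[(k, l). k \<leftarrow> [0..<7], l \<leftarrow> [0..<7], k < l].
     let r = rel7 T p q; ns = filter (\<lambda>i. i \<noteq> k \<and> i \<noteq> l) [0..<7]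
     in canon_gain (bits r ns) (map (r k) ns) (map (r l) ns))"

definition extreme6 :: "bool list \<Rightarrow> bool list \<Rightarrow> bool" where
  "extreme6 T p \<longleftrightarrow>
     list_all (\<lambda>i. imbalance (map (rel7 T p [] i) (filter (\<lambda>j. j \<noteq> i) [0..<6])) \<le> imbalance p) [0..<5]"

definition extreme7 :: "bool list \<Rightarrow> bool list \<Rightarrow> bool list \<Rightarrow> bool" where
  "extreme7 T p q \<longleftrightarrow>
     list_all (\<lambda>i. imbalance (map (rel7 T p q i) (filter (\<lambda>j. j \<noteq> i) [0..<7])) \<le> imbalance q) [0..<6]"

text \<open>With \<open>if\<close> in place of an implication, the 21 gains are not evaluated when
  extremality fails.\<close>

definition check7 :: "bool list \<Rightarrow> bool list \<Rightarrow> bool list \<Rightarrow> bool" where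
  "check7 T p q \<longleftrightarrow> (if extreme7 T p q then 53196000 \<le> total_gain T p q else True)"

definition check6 :: "bool list \<Rightarrow> bool list \<Rightarrow> bool" where
  "check6 T p \<longleftrightarrow> (if extreme6 T p then all_bits 6 (check7 T p) [] else True)"

section \<open>Soundness of the certificate\<close>

lemma bits_cong:
  assumes "\<And>i j. i \<in> set \<pi> \<Longrightarrow> j \<in> set \<pi> \<Longrightarrow> i \<noteq> j \<Longrightarrow> h i j = h' i j" and "distinct \<pi>"
  shows "bits h \<pi> = bits h' \<pi>"
  using assms
proof (induction \<pi>)
  case (Cons x xs)
  have "map (h x) xs = map (h' x) xs" using Cons.prems by auto
  moreover have "bits h xs = bits h' xs" using Cons by auto
  ultimately show ?case by simp
qed simp

lemma bits_map: "bits g (map f \<pi>) = bits (\<lambda>i j. g (f i) (f j)) \<pi>"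
  by (induction \<pi>) (simp_all add: o_def)

lemma length_bits5: "length xs = 5 \<Longrightarrow> length (bits g xs) = 10"
  by (auto simp: numeral_eq_Suc length_Suc_conv)

lemma less5: "(i::nat) < 5 \<longleftrightarrow> i = 0 \<or> i = 1 \<or> i = 2 \<or> i = 3 \<or> i = 4"
  by auto

lemma rel_bits:
  assumes "\<And>u v. g u v = g v u" "length xs = 5" "i < 5" "j < 5" "i \<noteq> j"
  shows "rel (bits g xs) i j = g (xs ! i) (xs ! j)"
proof -
  obtain x0 x1 x2 x3 x4 where xs: "xs = [x0, x1, x2, x3, x4]"
    using assms(2) by (auto simp: numeral_eq_Suc length_Suc_conv)
  have aux: "rel (bits g xs) i j = g (xs ! i) (xs ! j)" if "i < j" "j < 5" for i j
  proof -
    from that have "i < 5" "j < 5" by simp_all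
    then have "(i, j) \<in> {(0,1), (0,2), (0,3), (0,4), (1,2), (1,3), (1,4), (2,3), (2,4), (3,4)}"
      using \<open>i < j\<close> unfolding less5 by (elim disjE) simp_all
    then show ?thesis unfolding xs by (auto simp: rel_def)
  qed
  have comm: "rel T i j = rel T j i" for T i j
    by (simp add: rel_def max.commute min.commute)
  show ?thesis
  proof (cases "i < j")
    case False
    with assms(5) have "j < i" by simp
    then show ?thesis using aux[of j i] assms(3) comm[of _ i j] assms(1)[of "xs ! i"] by simp
  qed (use aux assms(4) in simp)
qed

text \<open>The condition on \<open>q\<close> is imposed only for pairs with the seventh vertex, so
  the lemma serves both \<open>extreme7\<close> and, with \<open>q = []\<close>,
  \<open>extreme6\<close>.\<close>

lemma rel7_bits:
  assumes sym: "\<And>u v. g u v = g v u" and xs: "length xs = 5" and ij: "i < 7" "j < 7" "i \<noteq> j"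
    and q: "max i j = 6 \<Longrightarrow> q = map (g v) (xs @ [u])"
  shows "rel7 (bits g xs) (map (g u) xs) q i j = g ((xs @ [u, v]) ! i) ((xs @ [u, v]) ! j)"
proof -
  have aux: "rel7 (bits g xs) (map (g u) xs) q i j = g ((xs @ [u, v]) ! i) ((xs @ [u, v]) ! j)"
    if "i < j" "j < 7" "j = 6 \<Longrightarrow> q = map (g v) (xs @ [u])" for i j
  proof -
    have "j < 5 \<or> j = 5 \<or> (j = 6 \<and> i < 5) \<or> (j = 6 \<and> i = 5)" using that(1,2) by presburger
    then consider "j < 5" | "j = 5" | "j = 6" "i < 5" | "j = 6" "i = 5" by blast
    then show ?thesis
    proof cases
      case 1
      then show ?thesis using that(1) xs rel_bits[OF sym xs, of i j] by (simp add: rel7_def nth_append)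
    next
      case 2
      then have "rel7 (bits g xs) (map (g u) xs) q i j = g u (xs ! i)"
        using that(1) xs by (simp add: rel7_def)
      then show ?thesis using 2 that(1) xs sym[of u "xs ! i"] by (simp add: nth_append)
    next
      case 3
      then have "rel7 (bits g xs) (map (g u) xs) q i j = g v (xs ! i)"
        using that(3) xs by (simp add: rel7_def nth_append)
      then show ?thesis using 3 xs sym[of v "xs ! i"] by (simp add: nth_append)
    next
      case 4
      then have "rel7 (bits g xs) (map (g u) xs) q i j = g v u"
        using that(3) xs by (simp add: rel7_def nth_append)
      then show ?thesis using 4 xs sym[of v u] by (simp add: nth_append)
    qed
  qed
  have comm: "rel7 T p q i j = rel7 T p q j i" for T p i j
    by (simp add: rel7_def rel_def max.commute min.commute)
  show ?thesis
  proof (cases "i < j")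
    case True
    show ?thesis by (rule aux[OF True ij(2)]) (use True q in simp)
  next
    case False
    then have "j < i" using ij(3) by simp
    have "rel7 (bits g xs) (map (g u) xs) q j i = g ((xs @ [u, v]) ! j) ((xs @ [u, v]) ! i)"
      by (rule aux[OF \<open>j < i\<close> ij(1)]) (use \<open>j < i\<close> q in simp)
    then show ?thesis by (simp only: comm[of _ _ i j] sym[of "(xs @ [u, v]) ! i"])
  qed
qed

lemma monochromatic_bits4:
  assumes "\<And>u v. g u v = g v u" "distinct [w, x, y, z]"
  shows "monochromatic g {w, x, y, z} \<longleftrightarrow>
    bits g [w, x, y, z] = replicate 6 True \<or> bits g [w, x, y, z] = replicate 6 False"
proof -
  have "monochromatic g {w, x, y, z} \<longleftrightarrow>
      (\<exists>t. g w x = t \<and> g w y = t \<and> g w z = t \<and> g x y = t \<and> g x z = t \<and> g y z = t)"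
    unfolding monochromatic_def
  proof (rule ex_cong1)
    fix t
    show "(\<forall>u\<in>{w, x, y, z}. \<forall>v\<in>{w, x, y, z}. u \<noteq> v \<longrightarrow> g u v = t) \<longleftrightarrow>
      (g w x = t \<and> g w y = t \<and> g w z = t \<and> g x y = t \<and> g x z = t \<and> g y z = t)"
      using assms(2) assms(1)[of x w] assms(1)[of y w] assms(1)[of z w] assms(1)[of y x] assms(1)[of z x]
        assms(1)[of z y]
      by (simp only: ball_simps distinct.simps list.set insert_iff empty_iff simp_thms de_Morgan_disj)
        blast
  qed
  then show ?thesis by (auto simp: numeral_eq_Suc ex_bool_eq)
qed

section \<open>Exchange of the colours, and positivity of the form\<close>

lemma flip_False [simp]: "flip False g = g"
  by (simp add: flip_def fun_eq_iff)

lemma flip_flip: "flip b (flip b' g) = flip (b \<noteq> b') g"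
  by (auto simp: flip_def fun_eq_iff)

lemma monochromatic_flip: "monochromatic (flip b g) S \<longleftrightarrow> monochromatic g S"
  by (cases b) (simp_all add: monochromatic_def flip_def ex_bool_eq disj_commute)

lemma k4_in_flip: "k4_in (flip b g) X = k4_in g X"
  by (simp add: k4_in_def monochromatic_flip)

interpretation psd_form 230400 form
proof
  fix U :: "nat set" and T p assume "finite U"
  have sq: "0 \<le> (\<Sum>y\<in>U. \<Sum>z\<in>U. \<Sum>v\<leftarrow>vs. lookup v (p y) * lookup v (p z))" for vs :: "int trie list"
  proof (induction vs)
    case (Cons v vs)
    \<comment> \<open>A single vector contributes the square of its sum over the vertices.\<close>
    have "(\<Sum>y\<in>U. \<Sum>z\<in>U. lookup v (p y) * lookup v (p z)) = (\<Sum>y\<in>U. lookup v (p y))\<^sup>2"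
      by (simp add: power2_eq_square sum_product)
    then have "0 \<le> (\<Sum>y\<in>U. \<Sum>z\<in>U. lookup v (p y) * lookup v (p z))" by simp
    with Cons show ?case by (simp add: sum.distrib)
  qed simp
  show "0 \<le> (\<Sum>y\<in>U. \<Sum>z\<in>U. form T (p y) (p z))"
  proof (cases "type_index T")
    case (Some i)
    then show ?thesis
      using sq[of "map (trie_of 5 \<circ> map Leaf) (snd (vectors ! i))"]
      by (simp add: form_def form_at_def split_beta flip: sum_distrib_left)
  qed (simp add: form_def)
qed

lemma ordered_form_flip: "ordered_form (flip b g) xs y z = ordered_form g xs y z"
  by (cases b) (simp_all add: ordered_form_def UNIV_bool flip_flip add.commute)

lemma excess_flip: "excess (flip b g) X y z = excess g X y z"
  by (simp add: excess_def k4_in_flip ordered_form_flip)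

lemma excess_commute: "excess g X y z = excess g X z y"
proof -
  have "form T p q = form T q p" for T p q
    by (simp add: form_def form_at_def mult.commute split: option.splits)
  then have "ordered_form g xs y z = ordered_form g xs z y" for xs by (simp add: ordered_form_def)
  then show ?thesis by (simp add: excess_def)
qed

lemma k4_in_type:
  assumes sym: "\<And>u v. g u v = g v u" and xs: "distinct xs" "length xs = 5"
  shows "k4_in g (set xs) = k4_type (bits g xs)"
proof -
  have *: "relabel False \<pi> (bits g xs) = bits g (map ((!) xs) \<pi>)" if "distinct \<pi>" "\<forall>i\<in>set \<pi>. i < 5" for \<pi>
    unfolding relabel_def bits_map using that rel_bits[OF sym xs(2)] by (intro bits_cong) auto
  obtain x0 x1 x2 x3 x4 where xs5: "xs = [x0, x1, x2, x3, x4]"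
    using xs(2) by (auto simp: numeral_eq_Suc length_Suc_conv)
  have d: "set xs - {x0} = {x1, x2, x3, x4}" "set xs - {x1} = {x0, x2, x3, x4}"
    "set xs - {x2} = {x0, x1, x3, x4}" "set xs - {x3} = {x0, x1, x2, x4}" "set xs - {x4} = {x0, x1, x2, x3}"
    using xs(1) unfolding xs5 by auto
  have "k4_in g (set xs) = of_bool (monochromatic g {x1, x2, x3, x4}) + of_bool (monochromatic g {x0, x2, x3, x4})
     + of_bool (monochromatic g {x0, x1, x3, x4}) + of_bool (monochromatic g {x0, x1, x2, x4})
     + of_bool (monochromatic g {x0, x1, x2, x3})"
  proof -
    have "(\<Sum>x\<in>set xs. f x) = f x0 + f x1 + f x2 + f x3 + f x4" for f :: "_ \<Rightarrow> int"
      using xs(1) by (simp add: xs5)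
    then show ?thesis by (simp only: k4_in_def d)
  qed
  also have "\<dots> = k4_type (bits g xs)"
  proof -
    let ?P = "\<lambda>\<pi>. relabel False \<pi> (bits g xs) = replicate 6 True \<or> relabel False \<pi> (bits g xs) = replicate 6 False"
    have P: "?P [i, j, k, l] \<longleftrightarrow> monochromatic g {xs ! i, xs ! j, xs ! k, xs ! l}"
      if "distinct [i, j, k, l]" "i < 5" "j < 5" "k < 5" "l < 5" for i j k l
      using *[of "[i, j, k, l]"] monochromatic_bits4[OF sym, of "xs ! i" "xs ! j" "xs ! k" "xs ! l"] that xs
      by (simp add: nth_eq_iff_index_eq del: bits.simps)
    have n: "xs ! 0 = x0" "xs ! 1 = x1" "xs ! 2 = x2" "xs ! 3 = x3" "xs ! 4 = x4"
      by (simp_all add: xs5)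
    have "?P [1, 2, 3, 4] \<longleftrightarrow> monochromatic g {x1, x2, x3, x4}" by (subst P) (simp_all only: n, simp_all)
    moreover have "?P [0, 2, 3, 4] \<longleftrightarrow> monochromatic g {x0, x2, x3, x4}" by (subst P) (simp_all only: n, simp_all)
    moreover have "?P [0, 1, 3, 4] \<longleftrightarrow> monochromatic g {x0, x1, x3, x4}" by (subst P) (simp_all only: n, simp_all)
    moreover have "?P [0, 1, 2, 4] \<longleftrightarrow> monochromatic g {x0, x1, x2, x4}" by (subst P) (simp_all only: n, simp_all)
    moreover have "?P [0, 1, 2, 3] \<longleftrightarrow> monochromatic g {x0, x1, x2, x3}" by (subst P) (simp_all only: n, simp_all)
    ultimately show ?thesis
      by (simp only: k4_type_def list.map sum_list.Cons sum_list.Nil add_0_right add.assoc)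
  qed
  finally show ?thesis .
qed

text \<open>The orderings of \<open>set xs\<close> are the lists \<open>map ((!) xs) \<pi>\<close>
  for permutations \<open>\<pi>\<close> of the positions, so the sum over orderings is determined by
  the colouring of \<open>xs\<close> and the two patterns.\<close>

lemma excess_gain:
  assumes sym: "\<And>u v. g u v = g v u" and xs: "distinct xs" "length xs = 5"
  shows "excess g (set xs) y z + 2500000 = gain (bits g xs) (map (g y) xs) (map (g z) xs)"
proof -
  let ?P = "permutations_of_set_list [0, 1, 2, 3, 4::nat]"
  have setP: "set ?P = permutations_of_set {0, 1, 2, 3, 4}"
    using permutations_of_list[of "[0, 1, 2, 3, 4::nat]"] by simp
  have distP: "distinct ?P" by (rule distinct_permutations_of_set_list) simp
  have im: "set xs = (!) xs ` {0, 1, 2, 3, 4}"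
    using xs(2) by (auto simp: in_set_conv_nth less5 image_iff)
  have inj: "inj_on ((!) xs) {0, 1, 2, 3, 4}"
    using xs by (intro inj_on_nth) auto
  have ord: "ordered_form g (map ((!) xs) \<pi>) y z = (\<Sum>b\<in>UNIV.
      form (relabel b \<pi> (bits g xs)) (act b \<pi> (map (g y) xs)) (act b \<pi> (map (g z) xs)))"
    if "\<pi> \<in> permutations_of_set {0, 1, 2, 3, 4}" for \<pi>
  proof -
    have \<pi>: "distinct \<pi>" "\<And>i. i \<in> set \<pi> \<Longrightarrow> i < 5"
      using that by (auto simp: permutations_of_set_def)
    have "bits (flip b g) (map ((!) xs) \<pi>) = relabel b \<pi> (bits g xs)" for b
      unfolding relabel_def bits_map using \<pi> rel_bits[OF sym xs(2)]
      by (intro bits_cong) (auto simp: flip_def)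
    moreover have "map (flip b g w) (map ((!) xs) \<pi>) = act b \<pi> (map (g w) xs)" for b w
      using \<pi>(2) xs(2) by (auto simp: act_def flip_def)
    ultimately show ?thesis by (simp add: ordered_form_def)
  qed
  have "(\<Sum>ys\<in>permutations_of_set (set xs). ordered_form g ys y z)
      = (\<Sum>\<pi>\<in>permutations_of_set {0, 1, 2, 3, 4}. ordered_form g (map ((!) xs) \<pi>) y z)"
    unfolding im permutations_of_set_image_inj[OF inj]
  proof (rule sum.reindex_cong[OF _ refl refl])
    show "inj_on (map ((!) xs)) (permutations_of_set {0, 1, 2, 3, 4})"
      using inj by (intro inj_onI) (auto simp: permutations_of_set_def inj_on_map_eq_map)
  qed
  also have "\<dots> = (\<Sum>\<pi>\<in>set ?P. \<Sum>b\<in>UNIV.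
      form (relabel b \<pi> (bits g xs)) (act b \<pi> (map (g y) xs)) (act b \<pi> (map (g z) xs)))"
    unfolding setP by (intro sum.cong refl ord)
  also have "\<dots> = (\<Sum>(b, \<pi>)\<leftarrow>relabellings.
      form (relabel b \<pi> (bits g xs)) (act b \<pi> (map (g y) xs)) (act b \<pi> (map (g z) xs)))"
    by (simp add: relabellings_def UNIV_bool sum.distrib sum_list_distinct_conv_sum_set[OF distP] o_def
        del: One_nat_def)
  finally show ?thesis
    by (simp add: excess_def gain_def k4_in_type[OF sym xs])
qed

text \<open>The excess depends on the set of the five vertices, not on their order, and is invariant
  under \<open>flip\<close>; it may therefore be computed at the representative named by the checked
  table.\<close>

lemma canon_gain_excess:
  assumes canon: "all_bits 10 canon_ok []" and sym: "\<And>u v. g u v = g v u"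
    and xs: "distinct xs" "length xs = 5"
  shows "canon_gain (bits g xs) (map (g y) xs) (map (g z) xs) = excess g (set xs) y z + 2500000"
proof -
  obtain j b \<pi> where l: "lookup canon (bits g xs) = (j, b, \<pi>)" by (cases "lookup canon (bits g xs)")
  have "canon_ok (bits g xs)" using all_bitsD[OF canon length_bits5[OF xs(2)]] by simp
  then have check: "canon_check (j, b, \<pi>) (bits g xs)" by (simp only: canon_ok_def l)
  then have \<pi>: "length \<pi> = 5" "distinct \<pi>" "\<And>i. i \<in> set \<pi> \<Longrightarrow> i < 5"
    and rl: "relabel b \<pi> (bits g xs) = types ! j"
    unfolding canon_check.simps list_all_iff by blast+
  let ?h = "flip b g" and ?ys = "map ((!) xs) \<pi>"
  have hsym: "?h u v = ?h v u" for u v using sym[of u v] by (simp add: flip_def)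
  have "set \<pi> = {..<5}"
    using \<pi> by (intro card_subset_eq) (auto simp: distinct_card)
  moreover have "set xs = (!) xs ` {..<5}" using xs(2) by (auto simp: set_conv_nth)
  ultimately have set: "set ?ys = set xs" by simp
  have "inj_on ((!) xs) (set \<pi>)" using xs \<pi>(3) by (intro inj_on_nth) auto
  then have dist: "distinct ?ys" using \<pi>(2) by (simp add: distinct_map)
  have "bits ?h ?ys = types ! j"
    unfolding rl[symmetric] relabel_def bits_map using \<pi> rel_bits[OF sym xs(2)]
    by (intro bits_cong) (auto simp: flip_def)
  moreover have "map (?h w) ?ys = act b \<pi> (map (g w) xs)" for w
    using \<pi>(3) xs(2) by (auto simp: act_def flip_def)
  ultimately have "gain (types ! j) (act b \<pi> (map (g y) xs)) (act b \<pi> (map (g z) xs))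
      = excess ?h (set ?ys) y z + 2500000"
    using excess_gain[OF hsym dist, where y=y and z=z] \<pi>(1) by simp
  moreover have "length (act b \<pi> p) = 5" for p using \<pi>(1) by (simp add: act_def)
  ultimately show ?thesis
    by (simp add: canon_gain_def l gain_bits_def excess_flip set del: set_map)
qed

section \<open>Extremal vertices and the inequality on a single 7-set\<close>

definition imb :: "('v \<Rightarrow> 'v \<Rightarrow> bool) \<Rightarrow> 'v set \<Rightarrow> 'v \<Rightarrow> int" where
  "imb g W u = \<bar>2 * int (card {x \<in> W - {u}. g u x}) - int (card (W - {u}))\<bar>"

text \<open>An exchange of colours replaces the degree by its complement in
  \<open>card (W - {u})\<close>, which only changes the sign inside the absolute value.\<close>

lemma imb_flip:
  assumes "finite W"
  shows "imb (flip b g) W u = imb g W u"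
proof (cases b)
  case True
  let ?A = "{x \<in> W - {u}. g u x}"
  have "{x \<in> W - {u}. \<not> g u x} = (W - {u}) - ?A" by auto
  moreover have "card (W - {u} - ?A) = card (W - {u}) - card ?A" "card ?A \<le> card (W - {u})"
    using assms by (intro card_Diff_subset card_mono; auto)+
  ultimately have "int (card {x \<in> W - {u}. \<not> g u x}) = int (card (W - {u})) - int (card ?A)"
    by (simp only: of_nat_diff)
  then show ?thesis using True by (simp only: imb_def flip_def simp_thms) arith
qed simp

lemma imbalance_imb:
  assumes "distinct ys" "set ys = W - {u}"
  shows "imbalance (map (g u) ys) = imb g W u"
proof -
  have "count_list (map f zs) True = length (filter f zs)" for f and zs :: "'a list"
    by (induction zs) auto
  then have "count_list (map (g u) ys) True = card {x \<in> W - {u}. g u x}"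
    using assms by (simp add: distinct_length_filter Int_def conj_commute)
  then show ?thesis using assms by (simp add: imbalance_def imb_def distinct_card[symmetric])
qed

lemma imb_max:
  assumes "finite W" "W \<noteq> {}"
  obtains v where "v \<in> W" "\<And>u. u \<in> W \<Longrightarrow> imb g W u \<le> imb g W v"
proof -
  have "Max (imb g W ` W) \<in> imb g W ` W" using assms by (intro Max_in) auto
  then obtain v where "v \<in> W" "imb g W v = Max (imb g W ` W)" by force
  then show ?thesis using that assms by (metis Max_ge finite_imageI image_eqI)
qed

lemma set_nth_filter:
  assumes "distinct ws" "i < length ws" "ns = [0..<length ws]"
  shows "set (map ((!) ws) (filter (\<lambda>j. j \<noteq> i) ns)) = set ws - {ws ! i}"
    and "distinct (map ((!) ws) (filter (\<lambda>j. j \<noteq> i) ns))"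
  using assms by (auto simp: in_set_conv_nth image_iff nth_eq_iff_index_eq distinct_map inj_on_nth)

lemma upt_lists: "[0..<5] = [0,1,2,3,4]" "[0..<6] = [0,1,2,3,4,5]" "[0..<7] = [0,1,2,3,4,5,6]"
  by (simp_all add: upt_rec)

lemma sum_pairs7:
  fixes E :: "nat \<Rightarrow> nat \<Rightarrow> int"
  assumes "\<And>k l. E k l = E l k"
  shows "(\<Sum>l\<in>{..<7}. \<Sum>k\<in>{..<7} - {l}. E k l) = 2 * (\<Sum>(k, l)\<leftarrow>[(k, l). k \<leftarrow> [0..<7], l \<leftarrow> [0..<7], k < l]. E k l)"
proof -
  have "{..<7::nat} = {0,1,2,3,4,5,6}" by auto
  then show ?thesis by (simp add: upt_lists insert_Diff_if assms)
qed

lemma sum_list_pairs7: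
  fixes E :: "nat \<Rightarrow> nat \<Rightarrow> int"
  shows "(\<Sum>(k, l)\<leftarrow>[(k, l). k \<leftarrow> [0..<7], l \<leftarrow> [0..<7], k < l]. E k l + c)
    = (\<Sum>(k, l)\<leftarrow>[(k, l). k \<leftarrow> [0..<7], l \<leftarrow> [0..<7], k < l]. E k l) + 21 * c"
  by (simp add: upt_lists)

text \<open>Every 7-set is normalised to a checked case: \<open>v\<close> maximises the imbalance in
  \<open>W\<close>, \<open>u\<close> does so in \<open>W - {v}\<close>, and the other five vertices
  are arranged into a representative colouring.\<close>

lemma local_gain:
  fixes g :: "'v \<Rightarrow> 'v \<Rightarrow> bool"
  assumes canon: "all_bits 10 canon_ok []" and chk: "\<And>T. T \<in> set types \<Longrightarrow> all_bits 5 (check6 T) []"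
    and sym: "\<And>u v. g u v = g v u" and W: "finite W" "card W = 7"
  shows "1392000 \<le> (\<Sum>z\<in>W. \<Sum>y\<in>W - {z}. excess g (W - {z} - {y}) y z)"
proof -
  obtain v where v: "v \<in> W" "\<And>x. x \<in> W \<Longrightarrow> imb g W x \<le> imb g W v"
    using imb_max[of W g] W by (metis card.empty zero_neq_numeral)
  let ?W = "W - {v}"
  have W': "finite ?W" "card ?W = 6" using W v(1) by auto
  \<comment> \<open>The imbalance of \<open>u\<close> ignores \<open>v\<close>, in accordance with
    \<open>extreme6\<close>, which sees six vertices only.\<close>
  obtain u where u: "u \<in> ?W" "\<And>x. x \<in> ?W \<Longrightarrow> imb g ?W x \<le> imb g ?W u"
    using imb_max[of ?W g] W' by (metis card.empty zero_neq_numeral)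
  obtain ys where ys: "set ys = ?W - {u}" "distinct ys"
    using finite_distinct_list[of "?W - {u}"] W' by auto
  have "card (?W - {u}) = 5" using W' u(1) by simp
  then have lys: "length ys = 5" using ys by (metis distinct_card)
  obtain j b \<pi> where l: "lookup canon (bits g ys) = (j, b, \<pi>)" by (cases "lookup canon (bits g ys)")
  have "canon_ok (bits g ys)" using all_bitsD[OF canon length_bits5[OF lys]] by simp
  then have check: "canon_check (j, b, \<pi>) (bits g ys)" by (simp only: canon_ok_def l)
  then have \<pi>: "length \<pi> = 5" "distinct \<pi>" "\<And>i. i \<in> set \<pi> \<Longrightarrow> i < 5" and j: "j < 18"
    and rl: "relabel b \<pi> (bits g ys) = types ! j"
    unfolding canon_check.simps list_all_iff by blast+
  \<comment> \<open>The colours are exchanged on all seven vertices at once; imbalances and excesses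
    do not notice.\<close>
  define h where "h = flip b g"
  define xs where "xs = map ((!) ys) \<pi>"
  have hsym: "h s t = h t s" for s t using sym[of s t] by (simp add: flip_def h_def)
  have "set \<pi> = {..<5}"
    using \<pi> by (intro card_subset_eq) (auto simp: distinct_card)
  moreover have "set ys = (!) ys ` {..<5}" using lys by (auto simp: set_conv_nth)
  ultimately have set: "set xs = ?W - {u}" using ys(1) by (simp add: xs_def)
  have "inj_on ((!) ys) (set \<pi>)" using ys(2) lys \<pi>(3) by (intro inj_on_nth) auto
  then have xs: "distinct xs" "length xs = 5" using \<pi>(1,2) by (simp_all add: distinct_map xs_def)
  have T: "bits h xs = types ! j"
    unfolding rl[symmetric] relabel_def bits_map xs_def h_def using \<pi> rel_bits[OF sym lys]
    by (intro bits_cong) (auto simp: flip_def)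
  have "length types = 18" by (simp add: types_def)
  then have Tin: "types ! j \<in> set types" using j by simp
  define ws where "ws = xs @ [u, v]"
  have ws: "distinct ws" "length ws = 7" "set ws = W"
    using xs set u(1) v(1) by (auto simp: ws_def)
  let ?T = "bits h xs" and ?p = "map (h u) xs" and ?q = "map (h v) (xs @ [u])"
  have r7: "rel7 ?T ?p ?q i k = h (ws ! i) (ws ! k)" if "i < 7" "k < 7" "i \<noteq> k" for i k
    unfolding ws_def by (rule rel7_bits[OF hsym xs(2) that]) simp
  have r6: "rel7 ?T ?p [] i k = h (ws ! i) (ws ! k)" if "i < 6" "k < 6" "i \<noteq> k" for i k
    unfolding ws_def by (rule rel7_bits[OF hsym xs(2)]) (use that in auto)
  have "extreme6 ?T ?p"
  proof -
    have ws6: "distinct (xs @ [u])" "set (xs @ [u]) = ?W" "length (xs @ [u]) = 6"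
      using xs set u(1) by auto
    have "imbalance (map (rel7 ?T ?p [] i) (filter (\<lambda>k. k \<noteq> i) [0..<6])) \<le> imbalance ?p" if "i < 5" for i
    proof -
      have "map (rel7 ?T ?p [] i) (filter (\<lambda>k. k \<noteq> i) [0..<6])
          = map (h ((xs @ [u]) ! i)) (map ((!) (xs @ [u])) (filter (\<lambda>k. k \<noteq> i) [0..<6]))"
        using that r6[of i] xs(2) by (auto simp: ws_def nth_append)
      then have "imbalance (map (rel7 ?T ?p [] i) (filter (\<lambda>k. k \<noteq> i) [0..<6])) = imb h ?W ((xs @ [u]) ! i)"
        using set_nth_filter[OF ws6(1), of i "[0..<6]"] that ws6
        by (simp only: imbalance_imb)
      moreover have "(xs @ [u]) ! i \<in> ?W" using that ws6 nth_mem[of i "xs @ [u]"] by simp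
      moreover have "imbalance ?p = imb h ?W u" using xs(1) set by (rule imbalance_imb)
      ultimately show ?thesis using u(2) W' by (simp add: h_def imb_flip)
    qed
    then show ?thesis by (simp add: extreme6_def list_all_iff)
  qed
  moreover have "check6 ?T ?p" using all_bitsD[OF chk[OF Tin], of ?p] xs(2) T by simp
  ultimately have "check7 ?T ?p ?q"
    using all_bitsD[of 6 "check7 ?T ?p" "[]" ?q] xs(2) by (simp add: check6_def)
  moreover have "extreme7 ?T ?p ?q"
  proof -
    have "imbalance (map (rel7 ?T ?p ?q i) (filter (\<lambda>k. k \<noteq> i) [0..<7])) \<le> imbalance ?q" if "i < 6" for i
    proof -
      have "map (rel7 ?T ?p ?q i) (filter (\<lambda>k. k \<noteq> i) [0..<7])
          = map (h (ws ! i)) (map ((!) ws) (filter (\<lambda>k. k \<noteq> i) [0..<7]))"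
        using that r7[of i] by auto
      then have "imbalance (map (rel7 ?T ?p ?q i) (filter (\<lambda>k. k \<noteq> i) [0..<7])) = imb h W (ws ! i)"
        using set_nth_filter[OF ws(1), of i "[0..<7]"] that ws
        by (simp only: imbalance_imb)
      moreover have "ws ! i \<in> W" using that ws nth_mem[of i ws] by simp
      moreover have "imbalance ?q = imb h W v" using xs(1) set u(1) v(1) by (intro imbalance_imb) auto
      ultimately show ?thesis using v(2) W by (simp add: h_def imb_flip)
    qed
    then show ?thesis by (simp add: extreme7_def list_all_iff)
  qed
  ultimately have total: "53196000 \<le> total_gain ?T ?p ?q" by (simp add: check7_def)
  define E where "E k l = excess h (W - {ws ! l} - {ws ! k}) (ws ! k) (ws ! l)" for k l
  have E_commute: "E k l = E l k" for k l
    by (simp add: E_def excess_commute[of h _ "ws ! k"] Diff_insert2[symmetric] insert_commute Diff_insert[symmetric])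
  have gain: "(let r = rel7 ?T ?p ?q; ns = filter (\<lambda>i. i \<noteq> k \<and> i \<noteq> l) [0..<7]
      in canon_gain (bits r ns) (map (r k) ns) (map (r l) ns)) = E k l + 2500000" if "k < l" "l < 7" for k l
  proof -
    let ?ns = "filter (\<lambda>i. i \<noteq> k \<and> i \<noteq> l) [0..<7]"
    let ?zs = "map ((!) ws) ?ns"
    have zs: "set ?zs = W - {ws ! l} - {ws ! k}" "distinct ?zs"
      using ws that by (auto simp: in_set_conv_nth image_iff nth_eq_iff_index_eq distinct_map inj_on_nth)
    have "ws ! l \<in> W" "ws ! k \<in> W - {ws ! l}"
      using ws that by (auto simp: nth_eq_iff_index_eq)
    then have "card (W - {ws ! l} - {ws ! k}) = 5"
      using W by (simp add: card_Diff_singleton)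
    then have lzs: "length ?zs = 5" using zs by (metis distinct_card)
    have "bits (rel7 ?T ?p ?q) ?ns = bits h ?zs"
      unfolding bits_map using r7 by (intro bits_cong) auto
    moreover have "map (rel7 ?T ?p ?q k) ?ns = map (h (ws ! k)) ?zs"
      "map (rel7 ?T ?p ?q l) ?ns = map (h (ws ! l)) ?zs"
      using r7 that by auto
    ultimately show ?thesis
      using canon_gain_excess[where g=h, OF canon hsym zs(2) lzs, where y="ws ! k" and z="ws ! l"]
      by (simp only: Let_def E_def zs(1))
  qed
  have ws_image: "W - A = (!) ws ` ({..<7} - B)" if "A = (!) ws ` B" "B \<subseteq> {..<7}" for A B
  proof -
    have "W = (!) ws ` {..<7}" using ws by (auto simp: set_conv_nth)
    moreover have "inj_on ((!) ws) {..<7}" using ws by (intro inj_on_nth) auto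
    ultimately show ?thesis using that inj_on_image_set_diff[of "(!) ws" "{..<7}" "{..<7}" B] by auto
  qed
  have injw: "inj_on ((!) ws) A" if "A \<subseteq> {..<7}" for A
    using ws that by (intro inj_on_nth) auto
  have "(\<Sum>z\<in>W. \<Sum>y\<in>W - {z}. excess g (W - {z} - {y}) y z)
      = (\<Sum>z\<in>W. \<Sum>y\<in>W - {z}. excess h (W - {z} - {y}) y z)"
    by (simp add: h_def excess_flip)
  also have "\<dots> = (\<Sum>l\<in>{..<7}. \<Sum>y\<in>W - {ws ! l}. excess h (W - {ws ! l} - {y}) y (ws ! l))"
    using ws_image[of "{}" "{}"] injw[of "{..<7}"] by (simp add: sum.reindex)
  also have "\<dots> = (\<Sum>l\<in>{..<7}. \<Sum>k\<in>{..<7} - {l}. E k l)"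
  proof (rule sum.cong[OF refl])
    fix l :: nat assume "l \<in> {..<7}"
    then show "(\<Sum>y\<in>W - {ws ! l}. excess h (W - {ws ! l} - {y}) y (ws ! l)) = (\<Sum>k\<in>{..<7} - {l}. E k l)"
      using ws_image[of "{ws ! l}" "{l}"] injw[of "{..<7} - {l}"] by (simp add: sum.reindex E_def)
  qed
  also have "\<dots> = 2 * (\<Sum>(k, l)\<leftarrow>[(k, l). k \<leftarrow> [0..<7], l \<leftarrow> [0..<7], k < l]. E k l)"
    by (rule sum_pairs7[OF E_commute])
  \<comment> \<open>The threshold 53196000 contains the offset 2500000 for each of the 21 pairs,
    leaving 696000; the factor 2 comes from ordered pairs.\<close>
  also have "\<dots> \<ge> 2 * 696000"
  proof -
    have "total_gain ?T ?p ?q = (\<Sum>(k, l)\<leftarrow>[(k, l). k \<leftarrow> [0..<7], l \<leftarrow> [0..<7], k < l].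
        E k l + 2500000)"
      unfolding total_gain_def
      by (intro arg_cong[where f=sum_list] map_cong refl) (auto intro!: gain simp del: map_append)
    then show ?thesis using total sum_list_pairs7[of E 2500000] by linarith
  qed
  finally show ?thesis by simp
qed

section \<open>The limit\<close>

lemma mono_K4s_eq: "mono_K4s n c = {S \<in> nsets {..<n} 4. monochromatic (\<lambda>u v. c {u, v}) S}"
proof -
  have "(\<forall>e\<in>nsets S 2. c e = t) \<longleftrightarrow> (\<forall>u\<in>S. \<forall>v\<in>S. u \<noteq> v \<longrightarrow> c {u, v} = t)" for S :: "nat set" and t
    by (auto simp: nsets_2_eq)
  then show ?thesis by (simp add: mono_K4s_def monochromatic_def)
qed

lemma finite_two_colourings: "finite (two_colourings n)"
  unfolding two_colourings_def by (intro finite_PiE finite_imp_finite_nsets) auto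

lemma two_colourings_nonempty: "two_colourings n \<noteq> {}"
  by (simp add: two_colourings_def PiE_eq_empty_iff)

lemma k4_le: "c \<in> two_colourings n \<Longrightarrow> k4 n \<le> card (mono_K4s n c)"
  unfolding k4_def by (intro Min_le) (auto simp: finite_two_colourings)

lemma k4_attained: obtains c where "c \<in> two_colourings n" "k4 n = card (mono_K4s n c)"
proof -
  have "k4 n \<in> (\<lambda>c. card (mono_K4s n c)) ` two_colourings n"
    unfolding k4_def by (intro Min_in) (auto simp: finite_two_colourings two_colourings_nonempty)
  then show ?thesis using that by auto
qed

text \<open>The colouring is pulled back along a bijection from \<open>{..<n}\<close>;
  \<open>restrict\<close> makes it extensional, as \<open>two_colourings\<close> demands.\<close>

lemma k4_le_monochromatic:
  assumes "finite V" "card V = n"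
  shows "k4 n \<le> card {S \<in> nsets V 4. monochromatic (\<lambda>u v. c {u, v}) S}"
proof -
  obtain f where f: "bij_betw f {..<n} V"
    using ex_bij_betw_nat_finite[OF assms(1)] assms(2) by (auto simp: atLeast0LessThan)
  define d where "d = restrict (\<lambda>e. c (f ` e)) (nsets {..<n} 2)"
  have d: "d \<in> two_colourings n" by (simp add: d_def two_colourings_def)
  have inj: "inj_on f {..<n}" and im: "f ` {..<n} = V" using f by (auto simp: bij_betw_def)
  have "(`) f ` mono_K4s n d \<subseteq> {S \<in> nsets V 4. monochromatic (\<lambda>u v. c {u, v}) S}"
  proof clarify
    fix S assume S: "S \<in> mono_K4s n d"
    then have S4: "S \<in> nsets {..<n} 4" by (simp add: mono_K4s_def)
    then have "f ` S \<in> nsets V 4"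
      using inj im by (auto simp: nsets_def card_image inj_on_subset)
    moreover have "monochromatic (\<lambda>u v. c {u, v}) (f ` S)"
    proof -
      obtain t where t: "\<forall>e\<in>nsets S 2. d e = t" using S by (auto simp: mono_K4s_def)
      have "c {f u, f v} = t" if "u \<in> S" "v \<in> S" "f u \<noteq> f v" for u v
      proof -
        have "{u, v} \<in> nsets S 2" using that by (auto simp: doubleton_in_nsets_2)
        moreover have "{u, v} \<in> nsets {..<n} 2" using that S4 by (subst doubleton_in_nsets_2) (auto simp: nsets_def)
        ultimately show ?thesis using t unfolding d_def by (metis (no_types, lifting) image_empty image_insert restrict_apply')
      qed
      then show ?thesis by (auto simp: monochromatic_def)
    qed
    ultimately show "f ` S \<in> nsets V 4 \<and> monochromatic (\<lambda>u v. c {u, v}) (f ` S)" by simp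
  qed
  moreover have "inj_on ((`) f) (mono_K4s n d)"
    by (rule inj_on_subset[OF inj_on_image_Pow[OF inj]]) (auto simp: mono_K4s_def nsets_def)
  ultimately have "card (mono_K4s n d) \<le> card {S \<in> nsets V 4. monochromatic (\<lambda>u v. c {u, v}) S}"
    using finite_imp_finite_nsets[OF assms(1), of 4] by (intro card_inj_on_le[where f="(`) f"]) auto
  with k4_le[OF d] show ?thesis by simp
qed

text \<open>Delete each vertex in turn from an optimal colouring of \<open>n + 1\<close> vertices: a
  monochromatic \<open>K\<^sub>4\<close> survives exactly the \<open>n - 3\<close> deletions of
  vertices outside it.\<close>

lemma k4_Suc: "(n + 1) * k4 n \<le> (n - 3) * k4 (n + 1)"
proof -
  obtain c where c: "k4 (n + 1) = card (mono_K4s (n + 1) c)" by (rule k4_attained)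
  let ?m = "monochromatic (\<lambda>u v. c {u, v})" and ?V = "{..<n + 1}"
  have fin: "finite (nsets A 4)" if "finite A" for A :: "nat set"
    using that by (rule finite_imp_finite_nsets)
  have "(n + 1) * k4 n = (\<Sum>x\<in>?V. k4 n)" by simp
  also have "\<dots> \<le> (\<Sum>x\<in>?V. card {S \<in> nsets (?V - {x}) 4. ?m S})"
    by (intro sum_mono k4_le_monochromatic) auto
  also have "\<dots> = (\<Sum>x\<in>?V. \<Sum>S\<in>{S \<in> nsets ?V 4. ?m S}. of_bool (x \<notin> S))"
  proof (rule sum.cong[OF refl])
    fix x
    have "{S \<in> nsets (?V - {x}) 4. ?m S} = {S \<in> {S \<in> nsets ?V 4. ?m S}. x \<notin> S}"
      by (auto simp: nsets_def)
    then show "card {S \<in> nsets (?V - {x}) 4. ?m S} = (\<Sum>S\<in>{S \<in> nsets ?V 4. ?m S}. of_bool (x \<notin> S))"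
      using fin[of ?V] by (simp add: Int_def)
  qed
  also have "\<dots> = (\<Sum>S\<in>{S \<in> nsets ?V 4. ?m S}. \<Sum>x\<in>?V. of_bool (x \<notin> S))"
    by (rule sum.swap)
  also have "\<dots> = (\<Sum>S\<in>{S \<in> nsets ?V 4. ?m S}. n - 3)"
  proof (rule sum.cong[OF refl])
    fix S assume "S \<in> {S \<in> nsets ?V 4. ?m S}"
    then have "S \<subseteq> ?V" "finite S" "card S = 4" by (auto simp: nsets_def)
    then have "card (?V - S) = n - 3" by (simp add: card_Diff_subset)
    moreover have "?V \<inter> {x. x \<notin> S} = ?V - S" by auto
    ultimately show "(\<Sum>x\<in>?V. of_bool (x \<notin> S)) = n - 3"
      by (simp only: sum_of_bool_eq finite_lessThan of_nat_id)
  qed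
  also have "\<dots> = (n - 3) * k4 (n + 1)" by (simp only: c mono_K4s_eq sum_constant of_nat_id mult.commute)
  finally show ?thesis .
qed

lemma k4_le_choose: "k4 n \<le> n choose 4"
proof -
  obtain c where "k4 n = card (mono_K4s n c)" by (rule k4_attained)
  also have "\<dots> \<le> card (nsets {..<n} 4)"
    by (rule card_mono) (auto simp: mono_K4s_def finite_imp_finite_nsets)
  finally show ?thesis by simp
qed

text \<open>This is \<open>k4_Suc\<close> combined with (n+1 choose 4)(n-3) = (n+1)(n choose
  4).\<close>

lemma k4_density_mono: "incseq (\<lambda>n. real (k4 n) / real (n choose 4))"
proof (rule incseq_SucI)
  fix n
  show "real (k4 n) / real (n choose 4) \<le> real (k4 (Suc n)) / real (Suc n choose 4)"
  proof (cases "n < 4")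
    case True
    \<comment> \<open>The left density is then a division by zero, hence 0.\<close>
    then have "real (n choose 4) = 0" by simp
    then show ?thesis by (simp only: div_by_0) simp
  next
    case False
    have "((n + 1) choose 4) * (n - 3) = (n + 1) * (n choose 4)"
    proof -
      have "(n + 1 - 4) * ((n + 1) choose 4) = (n + 1) * (n choose 4)"
        using binomial_absorb_comp[of "n + 1" 4] by (simp only: add_diff_cancel_right')
      moreover have "n + 1 - 4 = n - 3" using False by simp
      ultimately show ?thesis by (simp only: mult.commute)
    qed
    then have absorb: "real ((n + 1) choose 4) * real (n - 3) = real (n + 1) * real (n choose 4)"
      by (metis of_nat_mult)
    have le: "real (n + 1) * real (k4 n) \<le> real (n - 3) * real (k4 (n + 1))"
      using k4_Suc[of n] by (metis of_nat_le_iff of_nat_mult)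
    have "real (n - 3) > 0" "real (n choose 4) > 0" "real ((n + 1) choose 4) > 0"
      using False by (simp_all add: zero_less_binomial)
    have "real (k4 n) * real ((n + 1) choose 4) * real (n - 3) = real (n + 1) * real (k4 n) * real (n choose 4)"
    proof -
      have "real (k4 n) * (real ((n + 1) choose 4) * real (n - 3)) = real (k4 n) * (real (n + 1) * real (n choose 4))"
        by (simp only: absorb)
      then show ?thesis by (simp only: mult_ac)
    qed
    also have "\<dots> \<le> real (n - 3) * real (k4 (n + 1)) * real (n choose 4)"
      by (intro mult_right_mono le) simp
    finally have "real (k4 n) * real ((n + 1) choose 4) * real (n - 3)
        \<le> real (k4 (n + 1)) * real (n choose 4) * real (n - 3)" by (simp only: mult_ac)
    then have "real (k4 n) * real ((n + 1) choose 4) \<le> real (k4 (n + 1)) * real (n choose 4)"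
      using \<open>real (n - 3) > 0\<close> by (simp add: mult_le_cancel_right)
    then show ?thesis
      using \<open>real (n choose 4) > 0\<close> \<open>real ((n + 1) choose 4) > 0\<close>
      by (simp add: divide_le_eq pos_le_divide_eq mult.commute)
  qed
qed

text \<open>\<open>lim\<close> denotes a limit only for convergent sequences, so this is what gives
  \<open>c4\<close> its meaning.\<close>

lemma k4_density_convergent: "convergent (\<lambda>n. real (k4 n) / real (n choose 4))"
proof (rule incseq_convergent[OF k4_density_mono, of 1])
  show "\<forall>n. real (k4 n) / real (n choose 4) \<le> 1"
    using k4_le_choose by (auto simp: divide_le_eq)
next
  fix L assume "(\<lambda>n. real (k4 n) / real (n choose 4)) \<longlonglongrightarrow> L"
  then show "convergent (\<lambda>n. real (k4 n) / real (n choose 4))" by (rule convergentI)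
qed

lemma c4_ge:
  assumes loc: "\<And>(g :: nat \<Rightarrow> nat \<Rightarrow> bool) W. (\<And>u v. g u v = g v u) \<Longrightarrow> finite W \<Longrightarrow> card W = 7 \<Longrightarrow>
    1392000 \<le> (\<Sum>z\<in>W. \<Sum>y\<in>W - {z}. excess g (W - {z} - {y}) y z)"
  shows "29 / 1008 \<le> c4"
proof -
  obtain C0 where C0: "\<forall>(g :: nat \<Rightarrow> nat \<Rightarrow> bool) xs y. length xs = 5 \<longrightarrow> ordered_form g xs y y \<le> C0"
    using ordered_form_bounded by (rule exE)
  \<comment> \<open>The maximum with 0 supplies the sign condition of
    \<open>local_to_global\<close>.\<close>
  define C where "C = max C0 0"
  have C: "ordered_form g xs y y \<le> C" if "length xs = 5" for g :: "nat \<Rightarrow> nat \<Rightarrow> bool" and xs y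
    using C0[rule_format, OF that, of g y] by (simp add: C_def)
  have C_nonneg: "0 \<le> C" by (simp add: C_def)
  \<comment> \<open>The error n (n choose 5), divided by (n-4)(n-5)(n-6)(n choose 4), is
    \<open>?err n / 5\<close>, and 120 / (5 * 230400) = 1/9600.\<close>
  let ?err = "\<lambda>n. real n / ((real n - 5) * (real n - 6))"
  have bound: "29 / 1008 - real_of_int C / 9600 * ?err n \<le> real (k4 n) / real (n choose 4)" if n: "n \<ge> 7" for n
  proof -
    obtain c where c: "k4 n = card (mono_K4s n c)" by (rule k4_attained)
    define g where "g u v = c {u, v}" for u v
    have "1392000 * int (n choose 7) \<le> 230400 * (int (n - 4) * int (n - 5) * int (n - 6)) *
        int (card {S \<in> nsets {..<n} 4. monochromatic g S}) + 120 * C * int n * int (n choose 5)"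
    proof (rule local_to_global[OF C C_nonneg _ n])
      fix W assume "W \<in> nsets {..<n} 7"
      then show "1392000 \<le> (\<Sum>z\<in>W. \<Sum>y\<in>W - {z}. excess g (W - {z} - {y}) y z)"
        by (intro loc) (auto simp: nsets_def g_def insert_commute)
    qed
    also have "card {S \<in> nsets {..<n} 4. monochromatic g S} = k4 n"
      by (simp add: c mono_K4s_eq g_def[abs_def])
    finally have "real_of_int (1392000 * int (n choose 7)) \<le> real_of_int (230400 * (int (n - 4) * int (n - 5) * int (n - 6)) *
        int (k4 n) + 120 * C * int n * int (n choose 5))"
      by (simp only: of_int_le_iff)
    then have main: "1392000 * real (n choose 7) \<le> 230400 * ((real n - 4) * (real n - 5) * (real n - 6)) *
        real (k4 n) + 120 * C * real n * real (n choose 5)"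
      using n by (simp add: of_nat_diff)
    have absorb: "real (Suc k) * real (n choose Suc k) = (real n - real k) * real (n choose k)" if "k < 7" for k
    proof -
      have "Suc k * (n choose Suc k) = (n - k) * (n choose k)"
        by (simp only: binomial_absorption binomial_absorb_comp)
      then have "real (Suc k) * real (n choose Suc k) = real (n - k) * real (n choose k)"
        by (metis of_nat_mult)
      then show ?thesis using that n by (simp add: of_nat_diff)
    qed
    have ch: "5 * real (n choose 5) = (real n - 4) * real (n choose 4)"
      "6 * real (n choose 6) = (real n - 5) * real (n choose 5)"
      "7 * real (n choose 7) = (real n - 6) * real (n choose 6)"
      using absorb[of 4] absorb[of 5] absorb[of 6] by simp_all
    define D where "D = real (n choose 4)"
    define P where "P = (real n - 4) * ((real n - 5) * (real n - 6))"
    have pos: "D > 0" "P > 0" "real n - 4 > 0" "(real n - 5) * (real n - 6) > 0"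
      using n by (simp_all add: D_def P_def zero_less_binomial)
    \<comment> \<open>Three absorption steps from (n choose 7) down to (n choose 4), with 210 = 5 *
      6 * 7.\<close>
    have "210 * real (n choose 7) = 30 * (7 * real (n choose 7))" by simp
    also have "\<dots> = 5 * (real n - 6) * (6 * real (n choose 6))" unfolding ch(3) by simp
    also have "\<dots> = (real n - 6) * (real n - 5) * (5 * real (n choose 5))" unfolding ch(2) by simp
    also have "\<dots> = P * D" unfolding ch(1) by (simp add: P_def D_def mult_ac)
    finally have C7: "real (n choose 7) = P * D / 210" by simp
    have "1392000 * (P * D / 210) \<le> 230400 * P * real (k4 n) + 24 * C * real n * (real n - 4) * D"
    proof -
      have "120 * C * real n * real (n choose 5) = 24 * C * real n * (5 * real (n choose 5))" by simp
      also have "\<dots> = 24 * C * real n * (real n - 4) * D" unfolding ch(1) by (simp add: D_def)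
      finally have e: "120 * C * real n * real (n choose 5) = 24 * C * real n * (real n - 4) * D" .
      have "(real n - 4) * (real n - 5) * (real n - 6) = P" by (simp add: P_def mult.assoc)
      from main[unfolded C7 e this] show ?thesis .
    qed
    then have "1392000 * (P * D / 210) / (230400 * (P * D))
        \<le> (230400 * P * real (k4 n) + 24 * C * real n * (real n - 4) * D) / (230400 * (P * D))"
      using pos by (intro divide_right_mono) simp_all
    also have "\<dots> = real (k4 n) / D + C / 9600 * (real n * (real n - 4) / P)"
      using pos by (simp add: field_simps)
    also have "real n * (real n - 4) / P = ?err n"
      using pos unfolding P_def by (simp add: mult.commute[of "real n - 4"])
    finally have "1392000 * (P * D / 210) / (230400 * (P * D)) \<le> real (k4 n) / D + C / 9600 * ?err n" .
    moreover have "1392000 * (P * D / 210) / (230400 * (P * D)) = 29 / 1008" using pos by simp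
    ultimately show ?thesis unfolding D_def by linarith
  qed
  have "?err \<longlonglongrightarrow> 0" by real_asymp
  then have "(\<lambda>n. 29 / 1008 - real_of_int C / 9600 * ?err n) \<longlonglongrightarrow> 29 / 1008 - real_of_int C / 9600 * 0"
    by (intro tendsto_intros)
  moreover have "(\<lambda>n. real (k4 n) / real (n choose 4)) \<longlonglongrightarrow> c4"
    using k4_density_convergent unfolding c4_def by (simp add: convergent_LIMSEQ_iff)
  ultimately have "29 / 1008 - real_of_int C / 9600 * 0 \<le> c4"
    by (rule LIMSEQ_le) (use bound in blast)
  then show ?thesis by simp
qed

section \<open>Evaluation of the certificate\<close>

text \<open>
  Tables are turned into ground rewrite rules: \<open>tabulate n f [] = t\<close> with \<open>t\<close> computed by the
  simplifier yields \<open>2 ^ n\<close> equations for \<open>f\<close> by injectivity of the trie constructors.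
\<close>

lemma lookup_simps:
  "lookup (Leaf a) [] = a"
  "lookup (Node l r) (True # bs) = lookup r bs"
  "lookup (Node l r) (False # bs) = lookup l bs"
  by simp_all

text \<open>As a congruence rule it lets only the key be simplified and spares the traversal of the
  tree at every lookup.\<close>

lemma lookup_cong: "bs = bs' \<Longrightarrow> lookup t bs = lookup t bs'"
  by simp

text \<open>Since \<open>lookup_cong\<close> shields the tree from rewriting, a named table has to
  be unfolded at the level of \<open>lookup\<close>.\<close>

lemma lookup_eq: "t = t' \<Longrightarrow> lookup t bs = lookup t' bs"
  by simp

lemma nth5:
  "[a, b, c, d, e] ! 0 = a" "[a, b, c, d, e] ! 1 = b" "[a, b, c, d, e] ! 2 = c"
  "[a, b, c, d, e] ! 3 = d" "[a, b, c, d, e] ! 4 = e" for a b c d e :: bool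
  by simp_all

lemma bool_neq: "(x \<noteq> False) = x" "(x \<noteq> True) = (\<not> x)"
  by simp_all

lemma act5:
  "act b [i, j, k, l, m] p = [p ! i \<noteq> b, p ! j \<noteq> b, p ! k \<noteq> b, p ! l \<noteq> b, p ! m \<noteq> b]"
  by (simp add: act_def)

lemma relabel5:
  "relabel b [i, j, k, l, m] T = [rel T i j \<noteq> b, rel T i k \<noteq> b, rel T i l \<noteq> b, rel T i m \<noteq> b,
     rel T j k \<noteq> b, rel T j l \<noteq> b, rel T j m \<noteq> b, rel T k l \<noteq> b, rel T k m \<noteq> b, rel T l m \<noteq> b]"
  by (simp add: relabel_def flip_def)

text \<open>All positions are spelled out, so evaluation needs no arithmetic with the index formula
  of \<open>rel\<close>.\<close>

lemma rel10:
  "rel [t0, t1, t2, t3, t4, t5, t6, t7, t8, t9] 0 1 = t0"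
  "rel [t0, t1, t2, t3, t4, t5, t6, t7, t8, t9] 0 2 = t1"
  "rel [t0, t1, t2, t3, t4, t5, t6, t7, t8, t9] 0 3 = t2"
  "rel [t0, t1, t2, t3, t4, t5, t6, t7, t8, t9] 0 4 = t3"
  "rel [t0, t1, t2, t3, t4, t5, t6, t7, t8, t9] 1 0 = t0"
  "rel [t0, t1, t2, t3, t4, t5, t6, t7, t8, t9] 1 2 = t4"
  "rel [t0, t1, t2, t3, t4, t5, t6, t7, t8, t9] 1 3 = t5"
  "rel [t0, t1, t2, t3, t4, t5, t6, t7, t8, t9] 1 4 = t6"
  "rel [t0, t1, t2, t3, t4, t5, t6, t7, t8, t9] 2 0 = t1"
  "rel [t0, t1, t2, t3, t4, t5, t6, t7, t8, t9] 2 1 = t4"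
  "rel [t0, t1, t2, t3, t4, t5, t6, t7, t8, t9] 2 3 = t7"
  "rel [t0, t1, t2, t3, t4, t5, t6, t7, t8, t9] 2 4 = t8"
  "rel [t0, t1, t2, t3, t4, t5, t6, t7, t8, t9] 3 0 = t2"
  "rel [t0, t1, t2, t3, t4, t5, t6, t7, t8, t9] 3 1 = t5"
  "rel [t0, t1, t2, t3, t4, t5, t6, t7, t8, t9] 3 2 = t7"
  "rel [t0, t1, t2, t3, t4, t5, t6, t7, t8, t9] 3 4 = t9"
  "rel [t0, t1, t2, t3, t4, t5, t6, t7, t8, t9] 4 0 = t3"
  "rel [t0, t1, t2, t3, t4, t5, t6, t7, t8, t9] 4 1 = t6"
  "rel [t0, t1, t2, t3, t4, t5, t6, t7, t8, t9] 4 2 = t8"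
  "rel [t0, t1, t2, t3, t4, t5, t6, t7, t8, t9] 4 3 = t9"
  by (simp_all add: rel_def)

\<comment> \<open>Right-hand sides are left schematic here and below: rewriting computes them, and
  the results become rules for the next stage.\<close>
schematic_goal types_nth:
  "types ! 0 = ?t0"
  "types ! 1 = ?t1"
  "types ! 2 = ?t2"
  "types ! 3 = ?t3"
  "types ! 4 = ?t4"
  "types ! 5 = ?t5"
  "types ! 6 = ?t6"
  "types ! 7 = ?t7"
  "types ! 8 = ?t8"
  "types ! 9 = ?t9"
  "types ! 10 = ?t10"
  "types ! 11 = ?t11"
  "types ! 12 = ?t12"
  "types ! 13 = ?t13"
  "types ! 14 = ?t14"
  "types ! 15 = ?t15"
  "types ! 16 = ?t16"
  "types ! 17 = ?t17"
  by (simp_all add: types_def)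

lemma tabulate_numeral:
  "tabulate 5 = tabulate (Suc (Suc (Suc (Suc (Suc 0)))))"
  "tabulate 6 = tabulate (Suc (Suc (Suc (Suc (Suc (Suc 0))))))"
  "tabulate 10 = tabulate (Suc (Suc (Suc (Suc (Suc (Suc (Suc (Suc (Suc (Suc 0))))))))))"
  by (simp_all add: numeral_eq_Suc)

lemmas tabulate_simps = tabulate_numeral tabulate.simps append.simps

lemma type_index_eval: "type_index T = find (\<lambda>i. types ! i = T) [0, 1, 2, 3, 4, 5, 6, 7, 8, 9, 10]"
proof -
  have "[0..<11] = [0, 1, 2, 3, 4, 5, 6, 7, 8, 9, 10]" by (simp add: upt_rec)
  then show ?thesis by (simp add: type_index_def)
qed

schematic_goal type_index_table: "tabulate 10 type_index [] = ?t"
  by (simp only: tabulate_simps type_index_eval find.simps types_nth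
        list.inject list.distinct simp_thms if_True if_False if_cancel)

lemmas type_index_values = type_index_table[unfolded tabulate_simps trie.inject]

lemma permutations_of_set_aux_list_eval:
  "permutations_of_set_aux_list acc [] = [acc]"
  "permutations_of_set_aux_list acc (y # ys) =
     List.bind (y # ys) (\<lambda>x. permutations_of_set_aux_list (x # acc) (remove1 x (y # ys)))"
  by (subst permutations_of_set_aux_list.simps; simp)+

schematic_goal relabellings_eval: "relabellings = ?t"
  \<comment> \<open>Keeping \<open>1\<close> as a numeral lets later rules such as
    \<open>rel10\<close> match.\<close>
  by (simp add: relabellings_def permutations_of_set_list_def permutations_of_set_aux_list_eval
        bind_simps del: One_nat_def)

lemma bool_eqs: "(True = True) = True" "(True = False) = False" "(False = True) = False"
  "(False = False) = True" "(\<not> True) = False" "(\<not> False) = True"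
  by simp_all

lemma concat_eval: "concat [] = []" "concat (xs # xss) = xs @ concat xss"
  by simp_all

lemma trie_of_eval:
  "trie_of 4 ts = hd (pair_up (pair_up (pair_up (pair_up ts))))"
  "trie_of 5 ts = hd (pair_up (pair_up (pair_up (pair_up (pair_up ts)))))"
  "trie_of 6 ts = hd (pair_up (pair_up (pair_up (pair_up (pair_up (pair_up ts))))))"
  by (simp_all add: numeral_eq_Suc)

lemma replicate6: "replicate 6 x = [x, x, x, x, x, x]"
  by (simp add: numeral_eq_Suc)

lemma relabel4:
  "relabel b [i, j, k, l] T = [rel T i j \<noteq> b, rel T i k \<noteq> b, rel T i l \<noteq> b,
     rel T j k \<noteq> b, rel T j l \<noteq> b, rel T k l \<noteq> b]"
  by (simp add: relabel_def flip_def)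

lemmas bool_list_simps = list.map concat_eval prod.case option.case append.simps
  relabel5 rel10 act5 nth5 bool_neq bool_eqs

lemmas int_simps = arith_simps arith_special Num.inc.simps Num.BitM.simps
  mult_1_left mult_1_right mult_minus1 mult_minus1_right minus_minus mult_zero_left mult_zero_right
  add_0_left add_0_right minus_zero diff_0_right diff_0 of_nat_numeral of_nat_1

schematic_goal hits_eval:
  "hits (types ! 0) = ?t0"
  "hits (types ! 1) = ?t1"
  "hits (types ! 2) = ?t2"
  "hits (types ! 3) = ?t3"
  "hits (types ! 4) = ?t4"
  "hits (types ! 5) = ?t5"
  "hits (types ! 6) = ?t6"
  "hits (types ! 7) = ?t7"
  "hits (types ! 8) = ?t8"
  "hits (types ! 9) = ?t9"
  "hits (types ! 10) = ?t10"
  "hits (types ! 11) = ?t11"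
  "hits (types ! 12) = ?t12"
  "hits (types ! 13) = ?t13"
  "hits (types ! 14) = ?t14"
  "hits (types ! 15) = ?t15"
  "hits (types ! 16) = ?t16"
  "hits (types ! 17) = ?t17"
  by (simp_all only: hits_def relabellings_eval types_nth bool_list_simps type_index_values)

schematic_goal k4_type_eval:
  "k4_type (types ! 0) = ?t0"
  "k4_type (types ! 1) = ?t1"
  "k4_type (types ! 2) = ?t2"
  "k4_type (types ! 3) = ?t3"
  "k4_type (types ! 4) = ?t4"
  "k4_type (types ! 5) = ?t5"
  "k4_type (types ! 6) = ?t6"
  "k4_type (types ! 7) = ?t7"
  "k4_type (types ! 8) = ?t8"
  "k4_type (types ! 9) = ?t9"
  "k4_type (types ! 10) = ?t10"
  "k4_type (types ! 11) = ?t11"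
  "k4_type (types ! 12) = ?t12"
  "k4_type (types ! 13) = ?t13"
  "k4_type (types ! 14) = ?t14"
  "k4_type (types ! 15) = ?t15"
  "k4_type (types ! 16) = ?t16"
  "k4_type (types ! 17) = ?t17"
  by (simp_all only: k4_type_def types_nth relabel4 replicate6 bool_list_simps list.inject simp_thms
    of_bool_eq sum_list.Cons sum_list.Nil int_simps)

schematic_goal vectors_nth:
  "vectors ! 0 = ?t0"
  "vectors ! 1 = ?t1"
  "vectors ! 2 = ?t2"
  "vectors ! 3 = ?t3"
  "vectors ! 4 = ?t4"
  "vectors ! 5 = ?t5"
  "vectors ! 6 = ?t6"
  "vectors ! 7 = ?t7"
  "vectors ! 8 = ?t8"
  "vectors ! 9 = ?t9"
  "vectors ! 10 = ?t10"
  by (simp_all add: vectors_def del: One_nat_def)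

schematic_goal form_at_eval:
  "form_at 0 p q = ?t0"
  "form_at 1 p q = ?t1"
  "form_at 2 p q = ?t2"
  "form_at 3 p q = ?t3"
  "form_at 4 p q = ?t4"
  "form_at 5 p q = ?t5"
  "form_at 6 p q = ?t6"
  "form_at 7 p q = ?t7"
  "form_at 8 p q = ?t8"
  "form_at 9 p q = ?t9"
  "form_at 10 p q = ?t10"
  by (simp_all only: form_at_def vectors_nth prod.case list.map o_apply trie_of_eval pair_up.simps list.sel
    sum_list.Cons sum_list.Nil)

text \<open>Both patterns are joined to one ten-bit key, so a table over pairs of patterns is a
  single trie.\<close>

definition form_bits :: "nat \<Rightarrow> bool list \<Rightarrow> int" where
  "form_bits i bs = form_at i (take 5 bs) (drop 5 bs)"

lemma form_bits_eval:
  "form_bits i [p0, p1, p2, p3, p4, q0, q1, q2, q3, q4] = form_at i [p0, p1, p2, p3, p4] [q0, q1, q2, q3, q4]"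
  by (simp add: form_bits_def)

schematic_goal form_tables:
  "tabulate 10 (form_bits 0) [] = ?t0"
  "tabulate 10 (form_bits 1) [] = ?t1"
  "tabulate 10 (form_bits 2) [] = ?t2"
  "tabulate 10 (form_bits 3) [] = ?t3"
  "tabulate 10 (form_bits 4) [] = ?t4"
  "tabulate 10 (form_bits 5) [] = ?t5"
  "tabulate 10 (form_bits 6) [] = ?t6"
  "tabulate 10 (form_bits 7) [] = ?t7"
  "tabulate 10 (form_bits 8) [] = ?t8"
  "tabulate 10 (form_bits 9) [] = ?t9"
  "tabulate 10 (form_bits 10) [] = ?t10"
  by (simp_all only: tabulate_simps form_bits_eval form_at_eval lookup_simps int_simps cong: lookup_cong)

lemmas form_values = form_tables[unfolded tabulate_simps trie.inject]

text \<open>Relabellings that meet no type with vectors contribute 0, so the sum collapses to one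
  over \<open>hits\<close>.\<close>

lemma gain_bits_eval:
  "gain_bits j [p0, p1, p2, p3, p4, q0, q1, q2, q3, q4] = 2500000 + 230400 * k4_type (types ! j)
     - (\<Sum>(b, \<pi>, i)\<leftarrow>hits (types ! j). form_at i (act b \<pi> [p0, p1, p2, p3, p4]) (act b \<pi> [q0, q1, q2, q3, q4]))"
proof -
  have "(\<Sum>(b, \<pi>)\<leftarrow>L. form (relabel b \<pi> T) (act b \<pi> p) (act b \<pi> q))
      = (\<Sum>(b, \<pi>, i)\<leftarrow>concat (map (\<lambda>(b, \<pi>). case type_index (relabel b \<pi> T) of
          None \<Rightarrow> [] | Some i \<Rightarrow> [(b, \<pi>, i)]) L). form_at i (act b \<pi> p) (act b \<pi> q))" for L T p q
    by (induction L) (auto simp: form_def split: option.splits)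
  then show ?thesis by (simp add: gain_bits_def gain_def hits_def)
qed

\<comment> \<open>The pattern bits stay variables: relabellings are applied once per type, and only
  instances are evaluated in the tables.\<close>
schematic_goal gain_bits_eval_at:
  "gain_bits 0 [p0, p1, p2, p3, p4, q0, q1, q2, q3, q4] = ?t0"
  "gain_bits 1 [p0, p1, p2, p3, p4, q0, q1, q2, q3, q4] = ?t1"
  "gain_bits 2 [p0, p1, p2, p3, p4, q0, q1, q2, q3, q4] = ?t2"
  "gain_bits 3 [p0, p1, p2, p3, p4, q0, q1, q2, q3, q4] = ?t3"
  "gain_bits 4 [p0, p1, p2, p3, p4, q0, q1, q2, q3, q4] = ?t4"
  "gain_bits 5 [p0, p1, p2, p3, p4, q0, q1, q2, q3, q4] = ?t5"
  "gain_bits 6 [p0, p1, p2, p3, p4, q0, q1, q2, q3, q4] = ?t6"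
  "gain_bits 7 [p0, p1, p2, p3, p4, q0, q1, q2, q3, q4] = ?t7"
  "gain_bits 8 [p0, p1, p2, p3, p4, q0, q1, q2, q3, q4] = ?t8"
  "gain_bits 9 [p0, p1, p2, p3, p4, q0, q1, q2, q3, q4] = ?t9"
  "gain_bits 10 [p0, p1, p2, p3, p4, q0, q1, q2, q3, q4] = ?t10"
  "gain_bits 11 [p0, p1, p2, p3, p4, q0, q1, q2, q3, q4] = ?t11"
  "gain_bits 12 [p0, p1, p2, p3, p4, q0, q1, q2, q3, q4] = ?t12"
  "gain_bits 13 [p0, p1, p2, p3, p4, q0, q1, q2, q3, q4] = ?t13"
  "gain_bits 14 [p0, p1, p2, p3, p4, q0, q1, q2, q3, q4] = ?t14"
  "gain_bits 15 [p0, p1, p2, p3, p4, q0, q1, q2, q3, q4] = ?t15"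
  "gain_bits 16 [p0, p1, p2, p3, p4, q0, q1, q2, q3, q4] = ?t16"
  "gain_bits 17 [p0, p1, p2, p3, p4, q0, q1, q2, q3, q4] = ?t17"
  by (simp_all only: gain_bits_eval hits_eval k4_type_eval bool_list_simps form_bits_eval[symmetric]
    sum_list.Cons sum_list.Nil int_simps)

schematic_goal gain_tables:
  "tabulate 10 (gain_bits 0) [] = ?t0"
  "tabulate 10 (gain_bits 1) [] = ?t1"
  "tabulate 10 (gain_bits 2) [] = ?t2"
  "tabulate 10 (gain_bits 3) [] = ?t3"
  "tabulate 10 (gain_bits 4) [] = ?t4"
  "tabulate 10 (gain_bits 5) [] = ?t5"
  "tabulate 10 (gain_bits 6) [] = ?t6"
  "tabulate 10 (gain_bits 7) [] = ?t7"
  "tabulate 10 (gain_bits 8) [] = ?t8"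
  "tabulate 10 (gain_bits 9) [] = ?t9"
  "tabulate 10 (gain_bits 10) [] = ?t10"
  by (simp_all only: tabulate_simps bool_neq bool_eqs gain_bits_eval_at form_values int_simps)

text \<open>Facts are counted from 1, so 12-18 are the types 11 to 17. They have no hits, hence a
  constant gain that needs no table.\<close>

lemmas gain_values = gain_tables[unfolded tabulate_simps trie.inject]
  gain_bits_eval_at(12-18)

\<comment> \<open>The table of representatives as rewrite rules\<close>
schematic_goal canon_eval: "canon = ?t"
  by (simp only: canon_def canon_table_def Let_def list.map o_apply trie_of_eval pair_up.simps list.sel)

schematic_goal canon_table_eval: "tabulate 10 (lookup canon) [] = ?t"
  by (simp only: tabulate_simps canon_eval[THEN lookup_eq] lookup_simps cong: lookup_cong)

lemmas canon_values = canon_table_eval[unfolded tabulate_simps trie.inject]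

section \<open>The exhaustive check\<close>

lemma all_bits_numeral:
  "all_bits 5 = all_bits (Suc (Suc (Suc (Suc (Suc 0)))))"
  "all_bits 6 = all_bits (Suc (Suc (Suc (Suc (Suc (Suc 0))))))"
  "all_bits 10 = all_bits (Suc (Suc (Suc (Suc (Suc (Suc (Suc (Suc (Suc (Suc 0))))))))))"
  by (simp_all add: numeral_eq_Suc)

lemma canon_check5:
  "canon_check (j, b, [i, k, l, m, n]) T \<longleftrightarrow> j < 18 \<and> distinct [i, k, l, m, n] \<and> list_all (\<lambda>i. i < 5) [i, k, l, m, n]
     \<and> relabel b [i, k, l, m, n] T = types ! j"
  by simp

lemma all_canon_ok: "all_bits 10 canon_ok []"
  by (simp add: all_bits_numeral canon_ok_def canon_values canon_check5 relabel5 rel10 types_nth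
     del: canon_check.simps One_nat_def)

schematic_goal imbalance5: "tabulate 5 imbalance [] = ?t"
  by (simp add: tabulate_numeral imbalance_def)
schematic_goal imbalance6: "tabulate 6 imbalance [] = ?t"
  by (simp add: tabulate_numeral imbalance_def)

lemmas imbalance_values = imbalance5[unfolded tabulate_simps trie.inject]
  imbalance6[unfolded tabulate_simps trie.inject]

text \<open>Nested conditionals stop the evaluation at the first vertex with larger
  imbalance.\<close>

lemma extreme6_eval: "extreme6 [t0, t1, t2, t3, t4, t5, t6, t7, t8, t9] [p0, p1, p2, p3, p4] = (
    if imbalance [t0, t1, t2, t3, p0] \<le> imbalance [p0, p1, p2, p3, p4] then if imbalance [t0,
    t4, t5, t6, p1] \<le> imbalance [p0, p1, p2, p3, p4] then if imbalance [t1, t4, t7, t8, p2]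
    \<le> imbalance [p0, p1, p2, p3, p4] then if imbalance [t2, t5, t7, t9, p3] \<le> imbalance
    [p0, p1, p2, p3, p4] then if imbalance [t3, t6, t8, t9, p4] \<le> imbalance [p0, p1, p2, p3,
    p4] then True else False else False else False else False else False)"
  by (simp add: extreme6_def rel7_def rel_def upt_lists)

lemma extreme7_eval: "extreme7 [t0, t1, t2, t3, t4, t5, t6, t7, t8, t9] [p0, p1, p2, p3, p4] [q0, q1, q2, q3, q4, q5] = (
    if imbalance [t0, t1, t2, t3, p0, q0] \<le> imbalance [q0, q1, q2, q3, q4, q5] then if
    imbalance [t0, t4, t5, t6, p1, q1] \<le> imbalance [q0, q1, q2, q3, q4, q5] then if imbalance
    [t1, t4, t7, t8, p2, q2] \<le> imbalance [q0, q1, q2, q3, q4, q5] then if imbalance [t2, t5,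
    t7, t9, p3, q3] \<le> imbalance [q0, q1, q2, q3, q4, q5] then if imbalance [t3, t6, t8, t9, p4,
    q4] \<le> imbalance [q0, q1, q2, q3, q4, q5] then if imbalance [p0, p1, p2, p3, p4, q5] \<le>
    imbalance [q0, q1, q2, q3, q4, q5] then True else False else False else False else False else
    False else False)"
  by (simp add: extreme7_def rel7_def rel_def upt_lists)

lemma total_gain_eval: "total_gain [t0, t1, t2, t3, t4, t5, t6, t7, t8, t9] [p0, p1, p2, p3, p4] [q0, q1, q2, q3, q4, q5] =
    canon_gain [t7, t8, p2, q2, t9, p3, q3, p4, q4, q5] [t1, t2, t3, p0, q0] [t4, t5, t6, p1, q1] +
    canon_gain [t5, t6, p1, q1, t9, p3, q3, p4, q4, q5] [t0, t2, t3, p0, q0] [t4, t7, t8, p2, q2] +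
    canon_gain [t4, t6, p1, q1, t8, p2, q2, p4, q4, q5] [t0, t1, t3, p0, q0] [t5, t7, t9, p3, q3] +
    canon_gain [t4, t5, p1, q1, t7, p2, q2, p3, q3, q5] [t0, t1, t2, p0, q0] [t6, t8, t9, p4, q4] +
    canon_gain [t4, t5, t6, q1, t7, t8, q2, t9, q3, q4] [t0, t1, t2, t3, q0] [p1, p2, p3, p4, q5] +
    canon_gain [t4, t5, t6, p1, t7, t8, p2, t9, p3, p4] [t0, t1, t2, t3, p0] [q1, q2, q3, q4, q5] +
    canon_gain [t2, t3, p0, q0, t9, p3, q3, p4, q4, q5] [t0, t5, t6, p1, q1] [t1, t7, t8, p2, q2] +
    canon_gain [t1, t3, p0, q0, t8, p2, q2, p4, q4, q5] [t0, t4, t6, p1, q1] [t2, t7, t9, p3, q3] +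
    canon_gain [t1, t2, p0, q0, t7, p2, q2, p3, q3, q5] [t0, t4, t5, p1, q1] [t3, t8, t9, p4, q4] +
    canon_gain [t1, t2, t3, q0, t7, t8, q2, t9, q3, q4] [t0, t4, t5, t6, q1] [p0, p2, p3, p4, q5] +
    canon_gain [t1, t2, t3, p0, t7, t8, p2, t9, p3, p4] [t0, t4, t5, t6, p1] [q0, q2, q3, q4, q5] +
    canon_gain [t0, t3, p0, q0, t6, p1, q1, p4, q4, q5] [t1, t4, t8, p2, q2] [t2, t5, t9, p3, q3] +
    canon_gain [t0, t2, p0, q0, t5, p1, q1, p3, q3, q5] [t1, t4, t7, p2, q2] [t3, t6, t9, p4, q4] +
    canon_gain [t0, t2, t3, q0, t5, t6, q1, t9, q3, q4] [t1, t4, t7, t8, q2] [p0, p1, p3, p4, q5] +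
    canon_gain [t0, t2, t3, p0, t5, t6, p1, t9, p3, p4] [t1, t4, t7, t8, p2] [q0, q1, q3, q4, q5] +
    canon_gain [t0, t1, p0, q0, t4, p1, q1, p2, q2, q5] [t2, t5, t7, p3, q3] [t3, t6, t8, p4, q4] +
    canon_gain [t0, t1, t3, q0, t4, t6, q1, t8, q2, q4] [t2, t5, t7, t9, q3] [p0, p1, p2, p4, q5] +
    canon_gain [t0, t1, t3, p0, t4, t6, p1, t8, p2, p4] [t2, t5, t7, t9, p3] [q0, q1, q2, q4, q5] +
    canon_gain [t0, t1, t2, q0, t4, t5, q1, t7, q2, q3] [t3, t6, t8, t9, q4] [p0, p1, p2, p3, q5] +
    canon_gain [t0, t1, t2, p0, t4, t5, p1, t7, p2, p3] [t3, t6, t8, t9, p4] [q0, q1, q2, q3, q5] +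
    canon_gain [t0, t1, t2, t3, t4, t5, t6, t7, t8, t9] [p0, p1, p2, p3, p4] [q0, q1, q2, q3, q4]"
  by (simp add: total_gain_def rel7_def rel_def upt_lists)

lemma canon_gain5: "canon_gain_of (j, b, [i, k, l, m, n]) p q =
   gain_bits j (act b [i, k, l, m, n] p @ act b [i, k, l, m, n] q)"
  by simp

text \<open>The colouring comes last so that \<open>tabulate\<close> runs over it while the patterns
  stay variables: 1024 rules, where a table over all three arguments would have 2^20
  entries.\<close>

definition canon_at :: "bool list \<Rightarrow> bool list \<Rightarrow> bool list \<Rightarrow> int" where
  "canon_at p q T = canon_gain T p q"

schematic_goal canon_gain_trie: "tabulate 10 (canon_at [p0, p1, p2, p3, p4] [q0, q1, q2, q3, q4]) [] = ?t"
  by (simp only: tabulate_simps canon_at_def canon_gain_def canon_values canon_gain5 bool_list_simps)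

lemmas canon_gain_values = canon_gain_trie[unfolded tabulate_simps trie.inject canon_at_def]

text \<open>
  As congruence rules, these reflexive equations keep the simplifier from descending into arguments
  that are literal lists already.
\<close>

lemma eval_congs: "canon_gain T p q = canon_gain T p q" "imbalance p = imbalance p"
  "check6 T p = check6 T p" "check7 T p q = check7 T p q" "extreme6 T p = extreme6 T p" "extreme7 T p q = extreme7 T p q"
  "total_gain T p q = total_gain T p q" "pre = pre' \<Longrightarrow> all_bits n P pre = all_bits n P pre'"
  by simp_all

lemmas check_simps = all_bits_numeral all_bits.simps append.simps check6_def check7_def extreme6_eval extreme7_eval
  imbalance_values total_gain_eval canon_gain_values bool_eqs gain_values
  int_simps rel_simps if_True if_False simp_thms

lemma check_types: "\<forall>T\<in>set types. all_bits 5 (check6 T) []"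
proof -
  \<comment> \<open>Indices are written as numerals so that \<open>types_nth\<close> supplies each
    representative as a literal list.\<close>
  let ?js = "[0, 1, 2, 3, 4, 5, 6, 7, 8, 9, 10, 11, 12, 13, 14, 15, 16, 17]"
  have "map ((!) types) ?js = types" by (simp add: types_def)
  moreover have "list_all (\<lambda>T. all_bits 5 (check6 T) []) (map ((!) types) ?js)"
    by (simp only: list.map list.pred_inject types_nth check_simps cong: eval_congs if_weak_cong)
  ultimately show ?thesis by (simp only: list_all_iff)
qed

theorem theorem1:
  "convergent (\<lambda>n. real (k4 n) / real (n choose 4)) \<and>
   c4 \<ge> 204603019 / 7112448000 \<and>
   (204603019 / 7112448000 :: real) > 0.02876689"
proof -
  have "29 / 1008 \<le> c4"
    by (rule c4_ge) (use local_gain[OF all_canon_ok] check_types in blast)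
  then have "c4 \<ge> 204603019 / 7112448000" by simp
  then show ?thesis using k4_density_convergent by simp
qed

end
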